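(* Let $\Gamma\subset\mathrm{Aff}(\mathbf{R}^n)$ and $\Gamma'\subset\mathrm{Aff}(\mathbf{R}^{n'})$ be countable subgroups, let $\mathcal{Q}=\mathbf{R}^n/\Gamma$ and $\mathcal{Q}'=\mathbf{R}^{n'}/\Gamma'$ be equipped with the quotient diffeologies, and let $\mathrm{class}:\mathbf{R}^n\to\mathcal{Q}$ and $\mathrm{class}':\mathbf{R}^{n'}\to\mathcal{Q}'$ be the projections. Let $f$ be a local diffeomorphism from $\mathcal{Q}$ to $\mathcal{Q}'$, with non-empty domain. Then: (1) Every local smooth lifting $\tilde f$ of $f$ is a local diffeomorphism from $\mathbf{R}^n$ to $\mathbf{R}^{n'}$ around each point of its domain. In particular $n=n'$. (2) Let $x\in\mathrm{dom}(f)$, $x'=f(x)$, and let $r\in\mathbf{R}^n$ and $r'\in\mathbf{R}^{n'}$ be such that $\mathrm{class}(r)=x$ and $\mathrm{class}'(r')=x'$. Then there is a local smooth lifting $\tilde f$ of $f$, defined on an open neighborhood of $r$, such that $\tilde f(r)=r'$.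
   Context: $\mathrm{Aff}(\mathbf{R}^n)$ is the group of invertible affine transformations of $\mathbf{R}^n$. Diffeology: a diffeology on a set $X$ is a set of parametrizations (maps from open subsets of Euclidean spaces to $X$), called plots, containing the constant parametrizations, local in nature (a parametrization that is locally a plot is a plot), and stable under precomposition by smooth parametrizations. A map between diffeological spaces is smooth if it sends plots to plots by composition. The quotient diffeology on $\mathbf{R}^n/\Gamma$: the plots are the parametrizations that locally lift, along $\mathrm{class}$, to smooth parametrizations in $\mathbf{R}^n$. The D-topology of a diffeological space is the finest topology making all plots continuous; on $\mathbf{R}^n/\Gamma$ it is the quotient topology. A subset is given the subset diffeology (plots of the ambient space with values in the subset). A local diffeomorphism from a diffeological space $X$ to a diffeological space $X'$ is an injective map $f$ defined on a D-open subset $\mathrm{dom}(f)\subset X$, with D-open image in $X'$, such that $f$ and $f^{-1}$ are smooth for the subset diffeologies. A local smooth lifting of $f$ is a smooth map $\tilde f:\tilde V\to\mathbf{R}^{n'}$, defined on a non-empty open subset $\tilde V\subset\mathrm{class}^{-1}(\mathrm{dom}(f))\subset\mathbf{R}^n$, such that $\mathrm{class}'\circ\tilde f=f\circ\mathrm{class}$ on $\tilde V$. Saying that $\tilde f$ is a local diffeomorphism around a point means that its restriction to some open neighborhood of that point is a diffeomorphism onto an open subset of $\mathbf{R}^{n'}$. *)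

theory Defs
  imports "HOL-Analysis.Analysis" "HOL-Algebra.Bij" "HOL-Algebra.Group_Action"
begin

section \<open>Smooth maps between open subsets of the spaces \<open>R\<^sup>n\<close>\<close>

text \<open>Plots of a diffeology have domains of every dimension, so \<open>R\<^sup>n\<close> is the library's
  \<^const>\<open>Euclidean_space\<close>, which is indexed by a natural number: its points are the sequences of
  reals that vanish from index \<open>n\<close> on.\<close>

abbreviation Rn :: "nat \<Rightarrow> (nat \<Rightarrow> real) set"
  where "Rn n \<equiv> topspace (Euclidean_space n)"

definition partial_deriv :: "nat \<Rightarrow> ((nat \<Rightarrow> real) \<Rightarrow> real) \<Rightarrow> (nat \<Rightarrow> real) \<Rightarrow> real"
  where "partial_deriv i u x = deriv (\<lambda>t. u (x(i := t))) (x i)"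

definition smooth_fun_on :: "nat \<Rightarrow> (nat \<Rightarrow> real) set \<Rightarrow> ((nat \<Rightarrow> real) \<Rightarrow> real) \<Rightarrow> bool"
  where "smooth_fun_on k U u \<longleftrightarrow>
    (\<forall>is. set is \<subseteq> {..<k} \<longrightarrow>
       continuous_on U (foldr partial_deriv is u) \<and>
       (\<forall>x\<in>U. \<forall>i<k. (\<lambda>t. foldr partial_deriv is u (x(i := t))) differentiable at (x i)))"

definition smooth_on :: "nat \<Rightarrow> (nat \<Rightarrow> real) set \<Rightarrow> nat \<Rightarrow> ((nat \<Rightarrow> real) \<Rightarrow> nat \<Rightarrow> real) \<Rightarrow> bool"
  where "smooth_on k U m f \<longleftrightarrow>
    openin (Euclidean_space k) U \<and> f \<in> U \<rightarrow> Rn m \<and> (\<forall>j<m. smooth_fun_on k U (\<lambda>x. f x j))"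


section \<open>Diffeological spaces\<close>

text \<open>A parametrization of \<open>X\<close> is a triple \<open>(k, U, p)\<close> with \<open>U\<close> open in \<open>R\<^sup>k\<close> and \<open>p : U \<rightarrow> X\<close>,
  where \<open>p\<close> is normalised to be \<^const>\<open>undefined\<close> outside \<open>U\<close>.\<close>

type_synonym 'x param = "nat \<times> (nat \<Rightarrow> real) set \<times> ((nat \<Rightarrow> real) \<Rightarrow> 'x)"

definition params :: "'x set \<Rightarrow> 'x param set"
  where "params X = {(k, U, p). openin (Euclidean_space k) U \<and> p \<in> U \<rightarrow>\<^sub>E X}"

definition diffeology :: "'x set \<Rightarrow> 'x param set \<Rightarrow> bool"
  where "diffeology X D \<longleftrightarrow>
    D \<subseteq> params X \<and>
    (\<forall>k U. \<forall>x\<in>X. openin (Euclidean_space k) U \<longrightarrow> (k, U, \<lambda>r\<in>U. x) \<in> D) \<and>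
    (\<forall>k U p. (k, U, p) \<in> params X \<and>
       (\<forall>r\<in>U. \<exists>V. openin (Euclidean_space k) V \<and> r \<in> V \<and> V \<subseteq> U \<and> (k, V, restrict p V) \<in> D)
       \<longrightarrow> (k, U, p) \<in> D) \<and>
    (\<forall>k U p l V \<phi>. (k, U, p) \<in> D \<and> smooth_on l V k \<phi> \<and> \<phi> ` V \<subseteq> U
       \<longrightarrow> (l, V, compose V p \<phi>) \<in> D)"

definition dsmooth ::
    "'x set \<Rightarrow> 'x param set \<Rightarrow> 'y set \<Rightarrow> 'y param set \<Rightarrow> ('x \<Rightarrow> 'y) \<Rightarrow> bool"
  where "dsmooth X D X' D' f \<longleftrightarrow>
    f \<in> X \<rightarrow> X' \<and> (\<forall>(k, U, p)\<in>D. (k, U, compose U f p) \<in> D')"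

definition subset_diffeology :: "'x param set \<Rightarrow> 'x set \<Rightarrow> 'x param set"
  where "subset_diffeology D A = {(k, U, p) \<in> D. p ` U \<subseteq> A}"

definition D_topology :: "'x set \<Rightarrow> 'x param set \<Rightarrow> 'x topology"
  where "D_topology X D = topology (\<lambda>A. A \<subseteq> X \<and>
    (\<forall>(k, U, p)\<in>D. openin (Euclidean_space k) {r \<in> U. p r \<in> A}))"

text \<open>\<open>f\<close> is a partial map with domain \<open>A\<close>; its values outside \<open>A\<close> are irrelevant.\<close>

definition local_diffeomorphism ::
    "'x set \<Rightarrow> 'x param set \<Rightarrow> 'y set \<Rightarrow> 'y param set \<Rightarrow> 'x set \<Rightarrow> ('x \<Rightarrow> 'y) \<Rightarrow> bool"
  where "local_diffeomorphism X D X' D' A f \<longleftrightarrow>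
    openin (D_topology X D) A \<and> inj_on f A \<and> openin (D_topology X' D') (f ` A) \<and>
    dsmooth A (subset_diffeology D A) (f ` A) (subset_diffeology D' (f ` A)) f \<and>
    dsmooth (f ` A) (subset_diffeology D' (f ` A)) A (subset_diffeology D A) (inv_into A f)"


section \<open>Quotients of \<open>R\<^sup>n\<close> by affine groups\<close>

definition affine_map :: "nat \<Rightarrow> ((nat \<Rightarrow> real) \<Rightarrow> nat \<Rightarrow> real) \<Rightarrow> bool"
  where "affine_map n T \<longleftrightarrow>
    (\<exists>a b. \<forall>x\<in>Rn n. T x = (\<lambda>i. if i < n then (\<Sum>j<n. a i j * x j) + b i else 0))"

definition Aff :: "nat \<Rightarrow> ((nat \<Rightarrow> real) \<Rightarrow> nat \<Rightarrow> real) monoid"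
  where "Aff n = BijGroup (Rn n) \<lparr>carrier := {T \<in> Bij (Rn n). affine_map n T}\<rparr>"

definition proj ::
    "nat \<Rightarrow> ((nat \<Rightarrow> real) \<Rightarrow> nat \<Rightarrow> real) set \<Rightarrow> (nat \<Rightarrow> real) \<Rightarrow> (nat \<Rightarrow> real) set"
  where "proj n \<Gamma> = orbit (Aff n\<lparr>carrier := \<Gamma>\<rparr>) (\<lambda>\<gamma>. \<gamma>)"

definition quot :: "nat \<Rightarrow> ((nat \<Rightarrow> real) \<Rightarrow> nat \<Rightarrow> real) set \<Rightarrow> (nat \<Rightarrow> real) set set"
  where "quot n \<Gamma> = orbits (Aff n\<lparr>carrier := \<Gamma>\<rparr>) (Rn n) (\<lambda>\<gamma>. \<gamma>)"

definition quot_diffeology ::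
    "nat \<Rightarrow> ((nat \<Rightarrow> real) \<Rightarrow> nat \<Rightarrow> real) set \<Rightarrow> (nat \<Rightarrow> real) set param set"
  where "quot_diffeology n \<Gamma> = {(k, U, p) \<in> params (quot n \<Gamma>).
    \<forall>r\<in>U. \<exists>V s. r \<in> V \<and> V \<subseteq> U \<and> smooth_on k V n s \<and> (\<forall>x\<in>V. proj n \<Gamma> (s x) = p x)}"

definition local_smooth_lifting ::
    "nat \<Rightarrow> ((nat \<Rightarrow> real) \<Rightarrow> nat \<Rightarrow> real) set \<Rightarrow> nat \<Rightarrow> ((nat \<Rightarrow> real) \<Rightarrow> nat \<Rightarrow> real) set \<Rightarrow>
     (nat \<Rightarrow> real) set set \<Rightarrow> ((nat \<Rightarrow> real) set \<Rightarrow> (nat \<Rightarrow> real) set) \<Rightarrow>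
     (nat \<Rightarrow> real) set \<Rightarrow> ((nat \<Rightarrow> real) \<Rightarrow> nat \<Rightarrow> real) \<Rightarrow> bool"
  where "local_smooth_lifting n \<Gamma> n' \<Gamma>' A f V g \<longleftrightarrow>
    V \<noteq> {} \<and> openin (Euclidean_space n) V \<and> V \<subseteq> {r \<in> Rn n. proj n \<Gamma> r \<in> A} \<and>
    smooth_on n V n' g \<and> (\<forall>r\<in>V. proj n' \<Gamma>' (g r) = f (proj n \<Gamma> r))"

text \<open>The map \<open>g : V \<rightarrow> R\<^sup>m\<close>, with \<open>V \<subseteq> R\<^sup>n\<close>, is a local diffeomorphism around \<open>r\<close>.\<close>

definition local_diffeo_around ::
    "nat \<Rightarrow> nat \<Rightarrow> (nat \<Rightarrow> real) set \<Rightarrow> ((nat \<Rightarrow> real) \<Rightarrow> nat \<Rightarrow> real) \<Rightarrow> (nat \<Rightarrow> real) \<Rightarrow> bool"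
  where "local_diffeo_around n m V g r \<longleftrightarrow>
    (\<exists>W. openin (Euclidean_space n) W \<and> r \<in> W \<and> W \<subseteq> V \<and>
         openin (Euclidean_space m) (g ` W) \<and> inj_on g W \<and>
         smooth_on n W m g \<and> smooth_on m (g ` W) n (inv_into W g))"


section \<open>Adequacy of the definitions\<close>

lemma openin_D_topology:
  "openin (D_topology X D) A \<longleftrightarrow>
    A \<subseteq> X \<and> (\<forall>(k, U, p)\<in>D. openin (Euclidean_space k) {r \<in> U. p r \<in> A})"
proof -
  let ?P = "\<lambda>A. A \<subseteq> X \<and> (\<forall>(k, U, p)\<in>D. openin (Euclidean_space k) {r \<in> U. p r \<in> A})"
  have Int: "?P (S \<inter> T)" if "?P S" "?P T" for S T
  proof -
    have "{r \<in> U. p r \<in> S \<inter> T} = {r \<in> U. p r \<in> S} \<inter> {r \<in> U. p r \<in> T}"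
      for U :: "(nat \<Rightarrow> real) set" and p
      by auto
    with that show ?thesis by auto
  qed
  have Union: "?P (\<Union>K)" if K: "\<forall>S\<in>K. ?P S" for K
  proof -
    have "openin (Euclidean_space k) {r \<in> U. p r \<in> \<Union>K}" if "(k, U, p) \<in> D" for k U p
    proof -
      have "{r \<in> U. p r \<in> \<Union>K} = \<Union>((\<lambda>S. {r \<in> U. p r \<in> S}) ` K)"
        by auto
      moreover have "openin (Euclidean_space k) {r \<in> U. p r \<in> S}" if "S \<in> K" for S
        using K that \<open>(k, U, p) \<in> D\<close> by blast
      ultimately show ?thesis
        by (auto simp del: UN_simps intro!: openin_Union)
    qed
    with K show ?thesis by blast
  qed
  have "istopology ?P"
    unfolding istopology_def using Int Union by (intro conjI allI impI; assumption?) simp_all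
  then show ?thesis
    by (simp add: D_topology_def topology_inverse')
qed

text \<open>The D-topology is the finest topology on \<open>X\<close> that makes all plots continuous.\<close>

lemma continuous_map_D_topology:
  assumes "diffeology X D" "(k, U, p) \<in> D"
  shows "continuous_map (subtopology (Euclidean_space k) U) (D_topology X D) p"
proof -
  have U: "openin (Euclidean_space k) U" and p: "p \<in> U \<rightarrow>\<^sub>E X"
    using assms by (auto simp: diffeology_def params_def)
  have X: "topspace (D_topology X D) \<subseteq> X"
    using openin_D_topology[of X D "topspace (D_topology X D)"] by simp
  have "{r \<in> V. q r \<in> X} = V" if "(l, V, q) \<in> D" for l V q
    using that assms(1) by (auto simp: diffeology_def params_def)
  then have "openin (D_topology X D) X"
    using assms(1) by (auto simp: openin_D_topology diffeology_def params_def)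
  with X have "topspace (D_topology X D) = X"
    by (simp add: openin_subset subset_antisym)
  then show ?thesis
    using assms(2) p openin_subset[OF U] U
    by (auto simp: continuous_map openin_D_topology openin_open_subtopology Int_absorb1
        intro!: image_eqI)
qed

lemma D_topology_finest:
  assumes "diffeology X D" "topspace T = X"
    and "\<And>k U p. (k, U, p) \<in> D \<Longrightarrow> continuous_map (subtopology (Euclidean_space k) U) T p"
    and "openin T A"
  shows "openin (D_topology X D) A"
proof -
  have "openin (Euclidean_space k) {r \<in> U. p r \<in> A}" if "(k, U, p) \<in> D" for k U p
  proof -
    have U: "openin (Euclidean_space k) U"
      using assms(1) that by (auto simp: diffeology_def params_def)
    have "openin (subtopology (Euclidean_space k) U)
            {r \<in> topspace (subtopology (Euclidean_space k) U). p r \<in> A}"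
      using assms(3)[OF that] assms(4) by (rule openin_continuous_map_preimage)
    then show ?thesis
      using U openin_subset[OF U] by (simp add: openin_open_subtopology Int_absorb1)
  qed
  then show ?thesis
    using assms(2) openin_subset[OF assms(4)] by (auto simp: openin_D_topology)
qed

lemma affine_map_compose:
  assumes "affine_map n S" "affine_map n T" "T \<in> Rn n \<rightarrow> Rn n"
  shows "affine_map n (compose (Rn n) S T)"
proof -
  obtain a b where S: "\<And>x. x \<in> Rn n \<Longrightarrow> S x = (\<lambda>i. if i < n then (\<Sum>j<n. a i j * x j) + b i else 0)"
    using assms(1) unfolding affine_map_def by blast
  obtain c d where T: "\<And>x. x \<in> Rn n \<Longrightarrow> T x = (\<lambda>i. if i < n then (\<Sum>j<n. c i j * x j) + d i else 0)"
    using assms(2) unfolding affine_map_def by blast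
  show ?thesis
    unfolding affine_map_def
  proof (intro exI ballI)
    fix x assume x: "x \<in> Rn n"
    then have "T x \<in> Rn n" using assms(3) by auto
    have "(\<Sum>j<n. a i j * (\<Sum>k<n. c j k * x k)) = (\<Sum>k<n. (\<Sum>j<n. a i j * c j k) * x k)" for i
      unfolding sum_distrib_left sum_distrib_right mult.assoc by (rule sum.swap)
    then show "compose (Rn n) S T x =
        (\<lambda>i. if i < n then (\<Sum>k<n. (\<Sum>j<n. a i j * c j k) * x k) + ((\<Sum>j<n. a i j * d j) + b i) else 0)"
      using x \<open>T x \<in> Rn n\<close>
      by (auto simp: compose_def S T[OF x] fun_eq_iff distrib_left sum.distrib)
  qed
qed

lemma affine_map_inv:
  assumes "T \<in> Bij (Rn n)" "affine_map n T"
  shows "affine_map n (restrict (inv_into (Rn n) T) (Rn n))"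
proof -
  define S where "S = inv_into (Rn n) T"
  have bij: "bij_betw T (Rn n) (Rn n)"
    using assms(1) by (simp add: Bij_def)
  obtain a b where T: "\<And>x. x \<in> Rn n \<Longrightarrow> T x = (\<lambda>i. if i < n then (\<Sum>j<n. a i j * x j) + b i else 0)"
    using assms(2) unfolding affine_map_def by blast
  have S: "S y \<in> Rn n" "T (S y) = y" if "y \<in> Rn n" for y
    using bij that unfolding S_def
    by (auto simp: bij_betw_def inv_into_into f_inv_into_f simp del: topspace_Euclidean_space)
  define z where "z = (\<lambda>i::nat. 0::real)"
  define e where "e = (\<lambda>j i::nat. if i = j then 1 else 0::real)"
  have z: "z \<in> Rn n" and e: "e j \<in> Rn n" if "j < n" for j
    using that by (auto simp: topspace_Euclidean_space z_def e_def)
  have z: "z \<in> Rn n" by (auto simp: topspace_Euclidean_space z_def)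
  have lin: "S y = (\<lambda>i. S z i + (\<Sum>j<n. y j * (S (e j) i - S z i)))" (is "_ = ?r")
    if y: "y \<in> Rn n" for y
  proof -
    have r: "?r \<in> Rn n"
      using S(1)[OF z] S(1)[OF e] by (auto simp: topspace_Euclidean_space)
    have eq: "(\<Sum>k<n. a i k * S w k) = w i - b i" if "w \<in> Rn n" "i < n" for w i
      using S[OF that(1)] T[of "S w"] that(2) by (auto dest: fun_cong[of _ _ i])
    have "T ?r = y"
    proof
      fix i
      show "T ?r i = y i"
      proof (cases "i < n")
        case True
        have "(\<Sum>k<n. a i k * ?r k)
            = (\<Sum>k<n. a i k * S z k) + (\<Sum>k<n. \<Sum>j<n. a i k * (y j * (S (e j) k - S z k)))"
          by (simp add: distrib_left sum.distrib sum_distrib_left)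
        also have "(\<Sum>k<n. \<Sum>j<n. a i k * (y j * (S (e j) k - S z k)))
            = (\<Sum>j<n. y j * ((\<Sum>k<n. a i k * S (e j) k) - (\<Sum>k<n. a i k * S z k)))"
          by (subst sum.swap) (simp add: sum_distrib_left right_diff_distrib sum_subtractf mult_ac)
        also have "\<dots> = (\<Sum>j<n. y j * e j i)"
          using True by (intro sum.cong) (auto simp: eq e z, simp add: z_def)
        also have "\<dots> = y i"
          using True by (simp add: e_def if_distrib cong: if_cong)
        finally show ?thesis
          using True by (simp add: T[OF r] eq[OF z]) (simp add: z_def)
      next
        case False
        then show ?thesis using y by (simp add: T[OF r]) (simp add: topspace_Euclidean_space)
      qed
    qed
    then show ?thesis
      using inj_onD[OF bij_betw_imp_inj_on[OF bij], of "S y" ?r] S[OF y] r by simp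
  qed
  show ?thesis
    unfolding affine_map_def
  proof (intro exI ballI)
    fix y assume y: "y \<in> Rn n"
    show "restrict (inv_into (Rn n) T) (Rn n) y =
        (\<lambda>i. if i < n then (\<Sum>j<n. (S (e j) i - S z i) * y j) + S z i else 0)"
    proof
      fix i
      have "S y i = S z i + (\<Sum>j<n. y j * (S (e j) i - S z i))"
        using fun_cong[OF lin[OF y]] by blast
      moreover have "S y i = 0" if "\<not> i < n"
        using S(1)[OF y] that by (simp add: topspace_Euclidean_space)
      ultimately show "restrict (inv_into (Rn n) T) (Rn n) y i =
          (if i < n then (\<Sum>j<n. (S (e j) i - S z i) * y j) + S z i else 0)"
        using y by (simp add: mult.commute flip: S_def)
    qed
  qed
qed

lemma group_Aff: "group (Aff n)"
proof -
  interpret group "BijGroup (Rn n)" by (rule group_BijGroup)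
  have id: "affine_map n (\<lambda>x\<in>Rn n. x)"
    unfolding affine_map_def
    by (rule exI[of _ "\<lambda>i j. if i = j then 1 else 0"], rule exI[of _ "\<lambda>_. 0"])
       (auto simp: fun_eq_iff topspace_Euclidean_space if_distrib[of "\<lambda>c. c * _"] cong: if_cong)
  have "subgroup {T \<in> Bij (Rn n). affine_map n T} (BijGroup (Rn n))"
  proof (rule subgroupI)
    show "{T \<in> Bij (Rn n). affine_map n T} \<noteq> {}"
      using id id_Bij by blast
    show "inv\<^bsub>BijGroup (Rn n)\<^esub> T \<in> {T \<in> Bij (Rn n). affine_map n T}"
      if "T \<in> {T \<in> Bij (Rn n). affine_map n T}" for T
      using that affine_map_inv by (auto simp: inv_BijGroup restrict_inv_into_Bij)
    show "S \<otimes>\<^bsub>BijGroup (Rn n)\<^esub> T \<in> {T \<in> Bij (Rn n). affine_map n T}"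
      if "S \<in> {T \<in> Bij (Rn n). affine_map n T}" "T \<in> {T \<in> Bij (Rn n). affine_map n T}" for S T
      using that affine_map_compose[OF _ _ Bij_imp_funcset] by (auto simp: BijGroup_def compose_Bij)
  qed (auto simp: BijGroup_def)
  then show ?thesis
    unfolding Aff_def by (rule subgroup_imp_group)
qed

lemma proj_eq: "proj n \<Gamma> x = {\<gamma> x |\<gamma>. \<gamma> \<in> \<Gamma>}"
  by (simp add: proj_def orbit_def)

lemma quot_eq: "quot n \<Gamma> = proj n \<Gamma> ` Rn n"
  by (auto simp: quot_def proj_def orbits_def)

lemma openin_Rn_box:
  assumes "openin (Euclidean_space k) U" "x \<in> U"
  obtains e where "e > 0" "\<And>y. y \<in> Rn k \<Longrightarrow> (\<And>i. i < k \<Longrightarrow> \<bar>y i - x i\<bar> < e) \<Longrightarrow> y \<in> U"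
proof -
  obtain W where W: "openin (powertop_real UNIV) W" and UW: "U = W \<inter> {x. \<forall>i\<ge>k. x i = 0}"
    using assms(1) unfolding Euclidean_space_def openin_subtopology by blast
  have "x \<in> W" using UW assms(2) by blast
  then obtain B where B: "x \<in> (\<Pi>\<^sub>E i\<in>UNIV. B i)" "\<And>i. open (B i)" "(\<Pi>\<^sub>E i\<in>UNIV. B i) \<subseteq> W"
    using product_topology_open_contains_basis[OF W] by (metis open_openin)
  have "\<exists>e>0. ball (x i) e \<subseteq> B i" for i
    using B(1,2) by (auto simp: PiE_iff open_contains_ball)
  then obtain d where d: "\<And>i. d i > 0" "\<And>i. ball (x i) (d i) \<subseteq> B i"
    by metis
  define e where "e = Min (insert 1 (d ` {..<k}))"
  show thesis
  proof
    show "e > 0" unfolding e_def using d(1) by (subst Min_gr_iff) auto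
    fix y assume y: "y \<in> Rn k" "\<And>i. i < k \<Longrightarrow> \<bar>y i - x i\<bar> < e"
    have "y i \<in> B i" for i
    proof (cases "i < k")
      case True
      then have "e \<le> d i" unfolding e_def by (intro Min_le) auto
      with y(2)[OF True] have "y i \<in> ball (x i) (d i)"
        by (simp add: dist_real_def abs_minus_commute)
      then show ?thesis using d(2) by blast
    next
      case False
      then have "y i = x i"
        using y(1) UW assms(2) by (simp add: topspace_Euclidean_space)
      then show ?thesis using d[of i] by auto
    qed
    then have "y \<in> W" using B(3) by (auto simp: PiE_iff)
    then show "y \<in> U" using y(1) UW by (simp add: topspace_Euclidean_space)
  qed
qed

lemma eventually_line_in:
  assumes "openin (Euclidean_space k) U" "x \<in> U" "i < k"
  shows "eventually (\<lambda>t. x(i := t) \<in> U) (nhds (x i))"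
proof -
  obtain e where e: "e > 0" "\<And>y. y \<in> Rn k \<Longrightarrow> (\<And>i. i < k \<Longrightarrow> \<bar>y i - x i\<bar> < e) \<Longrightarrow> y \<in> U"
    using openin_Rn_box[OF assms(1,2)] by blast
  have x: "x \<in> Rn k" using openin_subset assms(1,2) by blast
  have "x(i := t) \<in> U" if "dist t (x i) < e" for t
    using that e x assms(3) by (intro e(2)) (auto simp: topspace_Euclidean_space dist_real_def)
  then show ?thesis
    using e(1) by (auto simp: eventually_nhds_metric)
qed

lemma smooth_fun_on_coinduct:
  assumes U: "openin (Euclidean_space k) U" and "P u"
    and cont: "\<And>u. P u \<Longrightarrow> continuous_on U u"
    and deriv: "\<And>u i. P u \<Longrightarrow> i < k \<Longrightarrow>
      \<exists>v. P v \<and> (\<forall>x\<in>U. ((\<lambda>t. u (x(i := t))) has_real_derivative v x) (at (x i)))"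
  shows "smooth_fun_on k U u"
proof -
  have *: "((\<lambda>t. w (x(i := t))) has_real_derivative v' x) (at (x i))"
    if "\<forall>x\<in>U. w x = v x" "\<forall>x\<in>U. ((\<lambda>t. v (x(i := t))) has_real_derivative v' x) (at (x i))"
      "x \<in> U" "i < k" for w v v' :: "(nat \<Rightarrow> real) \<Rightarrow> real" and x i
  proof -
    have "eventually (\<lambda>t. w (x(i := t)) = v (x(i := t))) (nhds (x i))"
      using eventually_line_in[OF U that(3,4)] by eventually_elim (use that(1) in blast)
    from DERIV_cong_ev[OF refl this refl] show ?thesis
      using that(2,3) by blast
  qed
  have ex: "\<exists>v. P v \<and> (\<forall>x\<in>U. foldr partial_deriv is u x = v x)" if "set is \<subseteq> {..<k}" for "is"
    using that
  proof (induction "is")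
    case Nil
    then show ?case using assms(2) by auto
  next
    case (Cons i "is")
    then obtain v where v: "P v" "\<forall>x\<in>U. foldr partial_deriv is u x = v x" by auto
    obtain v' where v': "P v'" "\<forall>x\<in>U. ((\<lambda>t. v (x(i := t))) has_real_derivative v' x) (at (x i))"
      using deriv[OF v(1), of i] Cons.prems by auto
    have "foldr partial_deriv (i # is) u x = v' x" if "x \<in> U" for x
      using *[OF v(2) v'(2) that] Cons.prems by (simp add: partial_deriv_def DERIV_imp_deriv)
    with v'(1) show ?case by blast
  qed
  show ?thesis
    unfolding smooth_fun_on_def
  proof (intro allI impI conjI ballI)
    fix "is" assume "set is \<subseteq> {..<k}"
    then obtain v where v: "P v" "\<forall>x\<in>U. foldr partial_deriv is u x = v x" using ex by blast
    show "continuous_on U (foldr partial_deriv is u)"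
      using cont[OF v(1)] v(2) continuous_on_cong[OF refl, of U _ v] by blast
    fix x i assume "x \<in> U" "i < k"
    then show "(\<lambda>t. foldr partial_deriv is u (x(i := t))) differentiable at (x i)"
      using deriv[OF v(1), of i] *[OF v(2)] real_differentiable_def by blast
  qed
qed

lemma smooth_fun_onD:
  assumes "smooth_fun_on k U u"
  shows "continuous_on U u"
    and "i < k \<Longrightarrow> x \<in> U \<Longrightarrow>
      ((\<lambda>t. u (x(i := t))) has_real_derivative partial_deriv i u x) (at (x i))"
    and "i < k \<Longrightarrow> smooth_fun_on k U (partial_deriv i u)"
proof -
  show "continuous_on U u"
    using assms[unfolded smooth_fun_on_def, rule_format, of "[]"] by simp
  show "((\<lambda>t. u (x(i := t))) has_real_derivative partial_deriv i u x) (at (x i))"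
    if "i < k" "x \<in> U"
    using assms[unfolded smooth_fun_on_def, rule_format, of "[]"] that
    by (simp add: partial_deriv_def DERIV_deriv_iff_real_differentiable)
  show "smooth_fun_on k U (partial_deriv i u)" if "i < k"
    unfolding smooth_fun_on_def
    using assms[unfolded smooth_fun_on_def, rule_format, of "_ @ [i]"] that by simp
qed

lemma chain_rule_partial:
  assumes U: "openin (Euclidean_space m) U" and c: "eventually (\<lambda>t. c t \<in> U) (nhds t0)"
    and c': "\<And>j. j < m \<Longrightarrow> ((\<lambda>t. c t j) has_real_derivative c' j) (at t0)"
    and g: "smooth_fun_on m U g"
  shows "((\<lambda>t. g (c t)) has_real_derivative (\<Sum>j<m. partial_deriv j g (c t0) * c' j)) (at t0)"
proof -
  define x where "x = c t0"
  define z where "z = (\<lambda>j t i. if i < j then c t i else x i)"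
  define T where "T = (\<lambda>j t. g (z (Suc j) t) - g (z j t))"
  have xU: "x \<in> U" using c by (auto simp: x_def dest: eventually_nhds_x_imp_x)
  then have x: "x \<in> Rn m" using openin_subset U by blast
  have lim: "((\<lambda>t. c t j) \<longlongrightarrow> x j) (at t0)" if "j < m" for j
    using DERIV_isCont[OF c'[OF that]] by (simp add: isCont_def x_def)
  have T: "(T j has_real_derivative partial_deriv j g x * c' j) (at t0)" if j: "j < m" for j
  proof -
    have mvt: "\<exists>\<xi>. \<bar>\<xi> - x j\<bar> \<le> \<bar>c t j - x j\<bar> \<and>
        T j t = (c t j - x j) * partial_deriv j g ((z j t)(j := \<xi>))"
      if seg: "\<And>\<xi>. \<bar>\<xi> - x j\<bar> \<le> \<bar>c t j - x j\<bar> \<Longrightarrow> (z j t)(j := \<xi>) \<in> U" for t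
    proof -
      define h where "h = (\<lambda>\<xi>. g ((z j t)(j := \<xi>)))"
      have h: "(h has_real_derivative partial_deriv j g ((z j t)(j := \<xi>))) (at \<xi>)"
        if "\<bar>\<xi> - x j\<bar> \<le> \<bar>c t j - x j\<bar>" for \<xi>
        using smooth_fun_onD(2)[OF g j seg[OF that]] by (simp add: h_def)
      have "z (Suc j) t = (z j t)(j := c t j)" "z j t = (z j t)(j := x j)"
        by (auto simp: z_def fun_eq_iff)
      then have Th: "T j t = h (c t j) - h (x j)" unfolding T_def h_def by metis
      consider "c t j = x j" | "c t j < x j" | "x j < c t j" by linarith
      then show ?thesis
      proof cases
        case 1
        then show ?thesis using Th by (intro exI[of _ "x j"]) simp
      next
        case 2
        have h': "(h has_real_derivative partial_deriv j g ((z j t)(j := \<xi>))) (at \<xi>)"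
          if "c t j \<le> \<xi>" "\<xi> \<le> x j" for \<xi>
          by (rule h) (use that in auto)
        obtain \<xi> where "c t j < \<xi>" "\<xi> < x j"
            "h (x j) - h (c t j) = (x j - c t j) * partial_deriv j g ((z j t)(j := \<xi>))"
          using MVT2[OF 2 h'] by blast
        then show ?thesis using Th by (intro exI[of _ \<xi>]) (auto simp: algebra_simps)
      next
        case 3
        have h': "(h has_real_derivative partial_deriv j g ((z j t)(j := \<xi>))) (at \<xi>)"
          if "x j \<le> \<xi>" "\<xi> \<le> c t j" for \<xi>
          by (rule h) (use that in auto)
        obtain \<xi> where "x j < \<xi>" "\<xi> < c t j"
            "h (c t j) - h (x j) = (c t j - x j) * partial_deriv j g ((z j t)(j := \<xi>))"
          using MVT2[OF 3 h'] by blast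
        then show ?thesis using Th by (intro exI[of _ \<xi>]) (auto simp: algebra_simps)
      qed
    qed
    have near: "eventually (\<lambda>t. \<forall>\<xi>. \<bar>\<xi> - x j\<bar> \<le> \<bar>c t j - x j\<bar> \<longrightarrow> (z j t)(j := \<xi>) \<in> V) (at t0)"
      if V: "openin (Euclidean_space m) V" "x \<in> V" for V
    proof -
      obtain e where e: "e > 0"
          "\<And>y. y \<in> Rn m \<Longrightarrow> (\<And>i. i < m \<Longrightarrow> \<bar>y i - x i\<bar> < e) \<Longrightarrow> y \<in> V"
        using openin_Rn_box[OF V] by blast
      have "eventually (\<lambda>t. \<forall>i\<in>{..<m}. \<bar>c t i - x i\<bar> < e) (at t0)"
        using lim e(1) by (auto simp: eventually_ball_finite_distrib tendsto_iff dist_real_def)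
      then show ?thesis
      proof eventually_elim
        case (elim t)
        show ?case
        proof (intro allI impI e(2))
          fix \<xi> assume \<xi>: "\<bar>\<xi> - x j\<bar> \<le> \<bar>c t j - x j\<bar>"
          show "(z j t)(j := \<xi>) \<in> Rn m"
            using x j by (auto simp: topspace_Euclidean_space z_def)
          show "\<bar>((z j t)(j := \<xi>)) i - x i\<bar> < e" if "i < m" for i
            using elim \<xi> e(1) j that by (auto simp: z_def intro: le_less_trans)
        qed
      qed
    qed
    define \<xi> where "\<xi> = (\<lambda>t. SOME \<xi>. \<bar>\<xi> - x j\<bar> \<le> \<bar>c t j - x j\<bar> \<and>
        T j t = (c t j - x j) * partial_deriv j g ((z j t)(j := \<xi>)))"
    have \<xi>: "eventually (\<lambda>t. \<bar>\<xi> t - x j\<bar> \<le> \<bar>c t j - x j\<bar> \<and>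
        T j t = (c t j - x j) * partial_deriv j g ((z j t)(j := \<xi> t))) (at t0)"
      using near[OF U xU]
    proof eventually_elim
      case (elim t)
      have "\<exists>\<xi>. \<bar>\<xi> - x j\<bar> \<le> \<bar>c t j - x j\<bar> \<and>
          T j t = (c t j - x j) * partial_deriv j g ((z j t)(j := \<xi>))"
        by (rule mvt) (rule elim[rule_format])
      then show ?case unfolding \<xi>_def by (rule someI_ex)
    qed
    have "((\<lambda>t. partial_deriv j g ((z j t)(j := \<xi> t))) \<longlongrightarrow> partial_deriv j g x) (at t0)"
    proof (rule topological_tendstoI)
      fix S assume S: "open S" "partial_deriv j g x \<in> S"
      have cont: "continuous_on U (partial_deriv j g)"
        by (rule smooth_fun_onD(1)[OF smooth_fun_onD(3)[OF g j]])
      obtain B where B: "open B" "B \<inter> U = partial_deriv j g -` S \<inter> U"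
        using cont[unfolded continuous_on_open_invariant, rule_format, OF S(1)] by blast
      have "openin (Euclidean_space m) (U \<inter> B)"
      proof -
        have "openin (powertop_real UNIV) B"
          using B(1) by (metis euclidean_product_topology open_openin)
        then have "openin (Euclidean_space m) (Rn m \<inter> B)"
          unfolding Euclidean_space_def openin_subtopology by auto
        from openin_Int[OF U this] show ?thesis
          using openin_subset[OF U] by (simp add: Int_absorb2 flip: Int_assoc)
      qed
      moreover have "x \<in> U \<inter> B" using xU S(2) B(2) by blast
      ultimately have "eventually (\<lambda>t. \<forall>\<xi>. \<bar>\<xi> - x j\<bar> \<le> \<bar>c t j - x j\<bar> \<longrightarrow>
          (z j t)(j := \<xi>) \<in> U \<inter> B) (at t0)"
        by (rule near)
      then show "eventually (\<lambda>t. partial_deriv j g ((z j t)(j := \<xi> t)) \<in> S) (at t0)"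
        using \<xi> by eventually_elim (use B(2) in blast)
    qed
    moreover have "((\<lambda>t. (c t j - x j) / (t - t0)) \<longlongrightarrow> c' j) (at t0)"
      using c'[OF j] by (simp add: has_field_derivative_iff x_def)
    ultimately have "((\<lambda>t. partial_deriv j g ((z j t)(j := \<xi> t)) * ((c t j - x j) / (t - t0)))
        \<longlongrightarrow> partial_deriv j g x * c' j) (at t0)"
      by (rule tendsto_mult)
    moreover have "eventually (\<lambda>t. partial_deriv j g ((z j t)(j := \<xi> t)) * ((c t j - x j) / (t - t0))
        = (T j t - T j t0) / (t - t0)) (at t0)"
      using \<xi>
    proof eventually_elim
      case (elim t)
      have "z (Suc j) t0 = z j t0" by (auto simp: z_def x_def fun_eq_iff)
      then have "T j t0 = 0" by (simp add: T_def)
      then show ?case using elim by simp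
    qed
    ultimately show ?thesis
      unfolding has_field_derivative_iff by (rule Lim_transform_eventually)
  qed
  have sum: "((\<lambda>t. g x + (\<Sum>j<m. T j t)) has_real_derivative
      0 + (\<Sum>j<m. partial_deriv j g x * c' j)) (at t0)"
    by (intro DERIV_add DERIV_const DERIV_sum T) auto
  have ev: "eventually (\<lambda>t. g x + (\<Sum>j<m. T j t) = g (c t)) (nhds t0)"
    using c
  proof eventually_elim
    case (elim t)
    then have "c t \<in> Rn m" using openin_subset[OF U] by blast
    then have "z m t = c t" "z 0 t = x"
      using x by (auto simp: z_def fun_eq_iff topspace_Euclidean_space)
    then show ?case
      unfolding T_def using sum_lessThan_telescope[of "\<lambda>j. g (z j t)" m] by simp
  qed
  from DERIV_cong_ev[OF refl ev refl] sum show ?thesis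
    by (simp add: x_def)
qed

text \<open>The functions on \<open>U\<close> generated by composites of smooth functions form an algebra that is
  closed under partial derivatives.\<close>

inductive comp_algebra for k U m W f where
  smooth: "smooth_fun_on k U h \<Longrightarrow> comp_algebra k U m W f h"
| comp: "smooth_fun_on m W g \<Longrightarrow> comp_algebra k U m W f (\<lambda>x. g (f x))"
| add: "comp_algebra k U m W f u \<Longrightarrow> comp_algebra k U m W f v \<Longrightarrow>
    comp_algebra k U m W f (\<lambda>x. u x + v x)"
| mult: "comp_algebra k U m W f u \<Longrightarrow> comp_algebra k U m W f v \<Longrightarrow>
    comp_algebra k U m W f (\<lambda>x. u x * v x)"

lemma smooth_fun_on_const:
  assumes "openin (Euclidean_space k) U"
  shows "smooth_fun_on k U (\<lambda>x. a)"
  by (rule smooth_fun_on_coinduct[OF assms, where P = "\<lambda>u. \<exists>a. u = (\<lambda>_. a)"])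
     (auto intro!: exI[of _ "\<lambda>_. 0"] continuous_on_const)

lemma smooth_on_continuous:
  assumes "smooth_on k U m f"
  shows "continuous_on U f"
proof (rule continuous_on_coordinatewise_then_product)
  fix j
  show "continuous_on U (\<lambda>x. f x j)"
  proof (cases "j < m")
    case True
    then show ?thesis using assms smooth_fun_onD(1) by (auto simp: smooth_on_def)
  next
    case False
    then have "f x j = 0" if "x \<in> U" for x
      using assms that by (auto simp: smooth_on_def topspace_Euclidean_space Pi_iff)
    then show ?thesis
      using continuous_on_cong[OF refl, of U "\<lambda>x. f x j" "\<lambda>_. 0"] by simp
  qed
qed

lemma smooth_fun_on_compose:
  assumes f: "smooth_on k U m f" and fW: "f ` U \<subseteq> W" and W: "openin (Euclidean_space m) W"
    and g: "smooth_fun_on m W g"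
  shows "smooth_fun_on k U (\<lambda>x. g (f x))"
proof (rule smooth_fun_on_coinduct[where P = "comp_algebra k U m W f"])
  show U: "openin (Euclidean_space k) U" using f by (simp add: smooth_on_def)
  show "comp_algebra k U m W f (\<lambda>x. g (f x))" using g by (rule comp_algebra.comp)
  have fj: "smooth_fun_on k U (\<lambda>x. f x j)" if "j < m" for j
    using f that by (simp add: smooth_on_def)
  fix u assume "comp_algebra k U m W f u"
  then have both: "continuous_on U u \<and> (\<forall>i<k. \<exists>v. comp_algebra k U m W f v \<and>
      (\<forall>x\<in>U. ((\<lambda>t. u (x(i := t))) has_real_derivative v x) (at (x i))))"
  proof induction
    case (smooth h)
    then show ?case
      by (blast intro: smooth_fun_onD comp_algebra.smooth)
  next
    case (comp g)
    have "continuous_on U (\<lambda>x. g (f x))"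
      by (rule continuous_on_compose2[OF smooth_fun_onD(1)[OF comp] smooth_on_continuous[OF f] fW])
    moreover have "\<exists>v. comp_algebra k U m W f v \<and>
        (\<forall>x\<in>U. ((\<lambda>t. g (f (x(i := t)))) has_real_derivative v x) (at (x i)))" if i: "i < k" for i
    proof (intro exI conjI ballI)
      let ?v = "\<lambda>M x. \<Sum>j<M. partial_deriv j g (f x) * partial_deriv i (\<lambda>x. f x j) x"
      have "M \<le> m \<Longrightarrow> comp_algebra k U m W f (?v M)" for M
      proof (induction M)
        case 0
        then show ?case using smooth_fun_on_const[OF U] by (auto intro: comp_algebra.smooth)
      next
        case (Suc M)
        then show ?case
          unfolding sum.lessThan_Suc
          by (intro comp_algebra.add comp_algebra.mult
              comp_algebra.smooth[OF smooth_fun_onD(3)[OF fj i]]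
              comp_algebra.comp[OF smooth_fun_onD(3)[OF comp]]) simp_all
      qed
      then show "comp_algebra k U m W f (?v m)" by simp
      fix x assume x: "x \<in> U"
      have "eventually (\<lambda>t. f (x(i := t)) \<in> W) (nhds (x i))"
        using eventually_line_in[OF U x i] by eventually_elim (use fW in blast)
      from chain_rule_partial[OF W this smooth_fun_onD(2)[OF fj i x] comp]
      show "((\<lambda>t. g (f (x(i := t)))) has_real_derivative ?v m x) (at (x i))"
        by simp
    qed
    ultimately show ?case by blast
  next
    case (add u v)
    have "\<exists>w. comp_algebra k U m W f w \<and>
        (\<forall>x\<in>U. ((\<lambda>t. u (x(i := t)) + v (x(i := t))) has_real_derivative w x) (at (x i)))"
      if "i < k" for i
    proof -
      obtain u' v' where "comp_algebra k U m W f u'" "comp_algebra k U m W f v'"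
          "\<forall>x\<in>U. ((\<lambda>t. u (x(i := t))) has_real_derivative u' x) (at (x i))"
          "\<forall>x\<in>U. ((\<lambda>t. v (x(i := t))) has_real_derivative v' x) (at (x i))"
        using add.IH \<open>i < k\<close> by blast
      then show ?thesis
        by (intro exI[of _ "\<lambda>x. u' x + v' x"]) (auto intro: comp_algebra.add DERIV_add)
    qed
    moreover have "continuous_on U (\<lambda>x. u x + v x)"
      using conjunct1[OF add.IH(1)] conjunct1[OF add.IH(2)] by (rule continuous_on_add)
    ultimately show ?case by (intro conjI allI impI)
  next
    case (mult u v)
    have "\<exists>w. comp_algebra k U m W f w \<and>
        (\<forall>x\<in>U. ((\<lambda>t. u (x(i := t)) * v (x(i := t))) has_real_derivative w x) (at (x i)))"
      if "i < k" for i
    proof -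
      obtain u' v' where *: "comp_algebra k U m W f u'" "comp_algebra k U m W f v'"
          "\<forall>x\<in>U. ((\<lambda>t. u (x(i := t))) has_real_derivative u' x) (at (x i))"
          "\<forall>x\<in>U. ((\<lambda>t. v (x(i := t))) has_real_derivative v' x) (at (x i))"
        using mult.IH \<open>i < k\<close> by blast
      have "((\<lambda>t. u (x(i := t)) * v (x(i := t))) has_real_derivative u' x * v x + v' x * u x) (at (x i))"
        if "x \<in> U" for x
        using DERIV_mult[OF bspec[OF *(3) that] bspec[OF *(4) that]] by simp
      then show ?thesis
        using *(1,2) mult.hyps
        by (intro exI[of _ "\<lambda>x. u' x * v x + v' x * u x"])
           (auto intro: comp_algebra.add comp_algebra.mult)
    qed
    moreover have "continuous_on U (\<lambda>x. u x * v x)"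
      using conjunct1[OF mult.IH(1)] conjunct1[OF mult.IH(2)] by (rule continuous_on_mult)
    ultimately show ?case by (intro conjI allI impI)
  qed
  show "continuous_on U u" using both by blast
  show "\<exists>v. comp_algebra k U m W f v \<and>
      (\<forall>x\<in>U. ((\<lambda>t. u (x(i := t))) has_real_derivative v x) (at (x i)))" if "i < k" for i
    using both that by blast
qed

lemma smooth_on_compose:
  assumes "smooth_on k U m f" "f ` U \<subseteq> W" "smooth_on m W l g"
  shows "smooth_on k U l (\<lambda>x. g (f x))"
proof -
  have W: "openin (Euclidean_space m) W" using assms(3) by (simp add: smooth_on_def)
  have "smooth_fun_on k U (\<lambda>x. g (f x) j)" if "j < l" for j
    by (rule smooth_fun_on_compose[OF assms(1,2) W]) (use assms(3) that in \<open>simp add: smooth_on_def\<close>)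
  then show ?thesis
    using assms by (auto simp: smooth_on_def)
qed

lemma smooth_on_subset:
  assumes "smooth_on k U m f" "openin (Euclidean_space k) V" "V \<subseteq> U"
  shows "smooth_on k V m f"
proof -
  have "smooth_fun_on k V u" if "smooth_fun_on k U u" for u
    unfolding smooth_fun_on_def
  proof (intro allI impI conjI ballI)
    fix "is" assume "set is \<subseteq> {..<k}"
    note u = that[unfolded smooth_fun_on_def, rule_format, OF this]
    show "continuous_on V (foldr partial_deriv is u)"
      using conjunct1[OF u] assms(3) by (rule continuous_on_subset)
    show "(\<lambda>t. foldr partial_deriv is u (x(i := t))) differentiable at (x i)"
      if "x \<in> V" "i < k" for x i
      using conjunct2[OF u] that assms(3) by blast
  qed
  then show ?thesis
    using assms by (auto simp: smooth_on_def)
qed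

lemma smooth_on_const:
  assumes "openin (Euclidean_space k) U" "a \<in> Rn m"
  shows "smooth_on k U m (\<lambda>_. a)"
  using assms smooth_fun_on_const by (auto simp: smooth_on_def)

lemma diffeology_quot: "diffeology (quot n \<Gamma>) (quot_diffeology n \<Gamma>)"
  unfolding diffeology_def
proof (intro conjI allI ballI impI)
  show "quot_diffeology n \<Gamma> \<subseteq> params (quot n \<Gamma>)"
    by (auto simp: quot_diffeology_def)
next
  fix k U x assume x: "x \<in> quot n \<Gamma>" and U: "openin (Euclidean_space k) U"
  then obtain a where "a \<in> Rn n" "x = proj n \<Gamma> a" by (auto simp: quot_eq)
  then show "(k, U, \<lambda>r\<in>U. x) \<in> quot_diffeology n \<Gamma>"
    using x U smooth_on_const[OF U] unfolding quot_diffeology_def params_def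
    by (auto intro!: exI[of _ U] exI[of _ "\<lambda>_. a"])
next
  fix k U p
  assume *: "(k, U, p) \<in> params (quot n \<Gamma>) \<and>
    (\<forall>r\<in>U. \<exists>V. openin (Euclidean_space k) V \<and> r \<in> V \<and> V \<subseteq> U \<and>
      (k, V, restrict p V) \<in> quot_diffeology n \<Gamma>)"
  have "\<exists>V s. r \<in> V \<and> V \<subseteq> U \<and> smooth_on k V n s \<and> (\<forall>x\<in>V. proj n \<Gamma> (s x) = p x)"
    if r: "r \<in> U" for r
  proof -
    obtain V where V: "r \<in> V" "V \<subseteq> U" "(k, V, restrict p V) \<in> quot_diffeology n \<Gamma>"
      using * r by blast
    then obtain V' s where "r \<in> V'" "V' \<subseteq> V" "smooth_on k V' n s"
        "\<forall>x\<in>V'. proj n \<Gamma> (s x) = restrict p V x"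
      by (auto simp: quot_diffeology_def)
    with V show ?thesis
      by (intro exI[of _ V'] exI[of _ s]) (auto simp: subset_iff)
  qed
  with * show "(k, U, p) \<in> quot_diffeology n \<Gamma>"
    by (auto simp: quot_diffeology_def)
next
  fix k U p l V \<phi>
  assume *: "(k, U, p) \<in> quot_diffeology n \<Gamma> \<and> smooth_on l V k \<phi> \<and> \<phi> ` V \<subseteq> U"
  then have V: "openin (Euclidean_space l) V" by (simp add: smooth_on_def)
  have "\<exists>V' s. r \<in> V' \<and> V' \<subseteq> V \<and> smooth_on l V' n s \<and>
      (\<forall>x\<in>V'. proj n \<Gamma> (s x) = compose V p \<phi> x)" if r: "r \<in> V" for r
  proof -
    have "\<phi> r \<in> U" using * r by auto
    then obtain W s where W: "\<phi> r \<in> W" "W \<subseteq> U" "smooth_on k W n s"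
        "\<forall>x\<in>W. proj n \<Gamma> (s x) = p x"
      using * by (auto simp: quot_diffeology_def)
    define V' where "V' = {x \<in> V. \<phi> x \<in> W}"
    have "openin (Euclidean_space l) V'"
    proof -
      have "continuous_map (top_of_set V) euclidean \<phi>"
        using * smooth_on_continuous[of l V k \<phi>] by simp
      moreover have "\<phi> ` V \<subseteq> {x. \<forall>i\<ge>k. x i = 0}"
        using * by (auto simp: smooth_on_def topspace_Euclidean_space)
      moreover have "subtopology (Euclidean_space l) V = subtopology (powertop_real UNIV) V"
        using openin_subset[OF V]
        by (simp add: Euclidean_space_def subtopology_subtopology Int_absorb1)
      ultimately have "continuous_map (subtopology (Euclidean_space l) V) (Euclidean_space k) \<phi>"
        by (auto simp: Euclidean_space_def[of k] euclidean_product_topology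
            continuous_map_in_subtopology image_subset_iff_funcset)
      moreover have "openin (Euclidean_space k) W"
        using W(3) by (simp add: smooth_on_def)
      ultimately have "openin (subtopology (Euclidean_space l) V)
          {x \<in> topspace (subtopology (Euclidean_space l) V). \<phi> x \<in> W}"
        by (rule openin_continuous_map_preimage)
      then show ?thesis
        using V openin_subset[OF V] by (simp add: openin_open_subtopology V'_def Int_absorb1)
    qed
    then have "smooth_on l V' k \<phi>"
      using * smooth_on_subset[of l V k \<phi> V'] by (auto simp: V'_def)
    then have "smooth_on l V' n (\<lambda>x. s (\<phi> x))"
      by (rule smooth_on_compose[OF _ _ W(3)]) (auto simp: V'_def)
    then show ?thesis
      using W r by (intro exI[of _ V'] exI[of _ "\<lambda>x. s (\<phi> x)"]) (auto simp: V'_def compose_def)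
  qed
  moreover have "(l, V, compose V p \<phi>) \<in> params (quot n \<Gamma>)"
    using * V by (auto simp: params_def quot_diffeology_def compose_def PiE_iff)
  ultimately show "(l, V, compose V p \<phi>) \<in> quot_diffeology n \<Gamma>"
    by (simp add: quot_diffeology_def)
qed

end

theory Submission
  imports Defs "HOL-Homology.Invariance_of_Domain"
begin

text \<open>A local smooth lifting \<open>g\<close> of \<open>f\<close> can be compared with a local smooth lifting \<open>h\<close> of
  \<open>f\<^sup>-\<^sup>1\<close> around \<open>g r\<close>: the composite \<open>h \<circ> g\<close> covers the identity of the quotient, so it moves
  each point inside its own orbit, that is, \<open>h (g x) = \<gamma> x\<close> for some \<open>\<gamma> \<in> \<Gamma>\<close> depending on \<open>x\<close>.
  As \<open>\<Gamma>\<close> is countable, Baire's theorem makes \<open>h \<circ> g\<close> locally equal to one element of \<open>\<Gamma>\<close> on a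
  dense open set. Its second partial derivatives vanish there, hence everywhere by continuity, and
  this rigidity makes the element \<open>\<gamma>\<close> constant near \<open>r\<close>
  (\<open>smooth_locally_in_countable_affine\<close>).

  Near \<open>r\<close>, then, \<open>\<gamma>\<^sup>-\<^sup>1 \<circ> h\<close> is a smooth left inverse of \<open>g\<close>
  (\<open>lifting_smooth_left_inverse\<close>). In particular \<open>g\<close> is injective near \<open>r\<close>, so invariance of
  domain bounds \<open>n\<close> by \<open>n'\<close>; the same argument for \<open>f\<^sup>-\<^sup>1\<close> gives the other inequality. Once the
  dimensions agree, invariance of domain also makes the image open, and the left inverse is a smooth
  inverse on it. No derivative has to be inverted.

  A lifting near a prescribed \<open>r\<close> exists because the composite of \<open>f\<close> with the projection is a
  plot of the target quotient; an element of \<open>\<Gamma>'\<close> then corrects its value at \<open>r\<close>.\<close>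

section \<open>Topology of open subsets of the spaces \<open>R\<^sup>k\<close>\<close>

lemma subtopology_Euclidean_space:
  assumes "U \<subseteq> Rn k"
  shows "subtopology (Euclidean_space k) U = top_of_set U"
  using assms
  by (simp add: Euclidean_space_def subtopology_subtopology Int_absorb1 euclidean_product_topology)

lemma openin_Euclidean_space_iff:
  assumes "openin (Euclidean_space k) U"
  shows "openin (top_of_set U) W \<longleftrightarrow> openin (Euclidean_space k) W \<and> W \<subseteq> U"
  using assms subtopology_Euclidean_space[OF openin_subset[OF assms]]
  by (metis openin_open_subtopology)

lemma smooth_on_continuous_map:
  assumes "smooth_on k U m f"
  shows "continuous_map (subtopology (Euclidean_space k) U) (Euclidean_space m) f"
proof -
  have U: "U \<subseteq> Rn k" and "f ` U \<subseteq> Rn m"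
    using assms openin_subset by (auto simp: smooth_on_def)
  then show ?thesis
    using smooth_on_continuous[OF assms]
    by (simp add: subtopology_Euclidean_space Euclidean_space_def[of m] euclidean_product_topology
        continuous_map_in_subtopology image_subset_iff_funcset topspace_Euclidean_space)
qed

lemma openin_preimage_smooth:
  assumes "smooth_on k U m f" "openin (Euclidean_space m) W"
  shows "openin (Euclidean_space k) {x \<in> U. f x \<in> W}"
proof -
  have U: "openin (Euclidean_space k) U" using assms by (simp add: smooth_on_def)
  show ?thesis
    using openin_continuous_map_preimage[OF smooth_on_continuous_map[OF assms(1)] assms(2)]
      U openin_subset[OF U]
    by (simp add: openin_open_subtopology Int_absorb1)
qed

definition cube :: "nat \<Rightarrow> (nat \<Rightarrow> real) \<Rightarrow> real \<Rightarrow> (nat \<Rightarrow> real) set"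
  where "cube k c e = {y \<in> Rn k. \<forall>i<k. \<bar>y i - c i\<bar> < e}"

lemma open_cube:
  assumes U: "openin (Euclidean_space k) U" "x \<in> U"
  obtains e where "e > 0" "cube k x e \<subseteq> U"
    "openin (Euclidean_space k) (cube k x e)"
proof -
  obtain e where e: "e > 0" "\<And>y. y \<in> Rn k \<Longrightarrow> (\<And>i. i < k \<Longrightarrow> \<bar>y i - x i\<bar> < e) \<Longrightarrow> y \<in> U"
    using openin_Rn_box[OF U] by blast
  have "open {y :: nat \<Rightarrow> real. \<bar>y i - x i\<bar> < e}" for i
    by (intro open_Collect_less continuous_on_rabs continuous_on_diff continuous_on_const
        continuous_on_product_coordinates)
  then have "open (\<Inter>i<k. {y :: nat \<Rightarrow> real. \<bar>y i - x i\<bar> < e})"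
    by (intro open_INT) auto
  then have "openin (top_of_set (Rn k)) (Rn k \<inter> (\<Inter>i<k. {y. \<bar>y i - x i\<bar> < e}))"
    by (rule openin_open_Int)
  moreover have "top_of_set (Rn k) = Euclidean_space k"
    using subtopology_Euclidean_space[of "Rn k" k] by simp
  moreover have "Rn k \<inter> (\<Inter>i<k. {y. \<bar>y i - x i\<bar> < e}) = cube k x e"
    by (auto simp: cube_def)
  moreover have "cube k x e \<subseteq> U" using e(2) by (auto simp: cube_def)
  ultimately show thesis using that[OF e(1)] by simp
qed

text \<open>Baire's theorem. It applies because an open subset of a completely metrizable space is itself
  completely metrizable.\<close>

lemma countable_closed_cover_interior:
  assumes V: "openin (Euclidean_space k) V" "V \<noteq> {}" and "countable I"
    and cover: "V \<subseteq> (\<Union>c\<in>I. F c)"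
    and closed: "\<And>c. c \<in> I \<Longrightarrow> closedin (top_of_set V) (F c)"
  obtains c W where "c \<in> I" "openin (Euclidean_space k) W" "W \<noteq> {}" "W \<subseteq> F c" "W \<subseteq> V"
proof (rule ccontr)
  assume "\<not> thesis"
  then have empty: "\<And>c W. c \<in> I \<Longrightarrow> openin (Euclidean_space k) W \<Longrightarrow> W \<subseteq> F c \<Longrightarrow> W \<subseteq> V \<Longrightarrow> W = {}"
    using that by blast
  have top: "top_of_set V = subtopology (Euclidean_space k) V"
    using subtopology_Euclidean_space[OF openin_subset[OF V(1)]] by simp
  have "top_of_set V interior_of \<Union> (F ` I) = {}"
  proof (rule Baire_category_alt)
    have "completely_metrizable_space (top_of_set V)"
      unfolding top by (rule completely_metrizable_space_openin[OF completely_metrizable_Euclidean_space V(1)])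
    then show "completely_metrizable_space (top_of_set V) \<or>
        locally_compact_space (top_of_set V) \<and> regular_space (top_of_set V)" ..
    show "countable (F ` I)" using assms(3) by simp
    fix T assume "T \<in> F ` I"
    then obtain c where c: "c \<in> I" "T = F c" by blast
    have "top_of_set V interior_of F c = {}"
    proof (rule empty[OF c(1)])
      have "openin (top_of_set V) (top_of_set V interior_of F c)" by (rule openin_interior_of)
      then show "openin (Euclidean_space k) (top_of_set V interior_of F c)"
          "top_of_set V interior_of F c \<subseteq> V"
        using openin_Euclidean_space_iff[OF V(1)] by blast+
    qed (rule interior_of_subset)
    with closed c show "closedin (top_of_set V) T \<and> top_of_set V interior_of T = {}" by simp
  qed
  moreover have "\<Union> (F ` I) = V"
    using cover closed closedin_subset by fastforce
  ultimately show False
    using V(2) interior_of_topspace[of "top_of_set V"] by simp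
qed

lemma continuous_zero_of_dense:
  fixes u :: "(nat \<Rightarrow> real) \<Rightarrow> real"
  assumes V: "openin (Euclidean_space k) V" and u: "continuous_on V u"
    and dense: "\<And>W. openin (Euclidean_space k) W \<Longrightarrow> W \<noteq> {} \<Longrightarrow> W \<subseteq> V \<Longrightarrow> \<exists>x\<in>W. u x = 0"
    and x: "x \<in> V"
  shows "u x = 0"
proof (rule ccontr)
  assume "u x \<noteq> 0"
  have "openin (top_of_set V) (V \<inter> u -` (- {0}))"
    by (rule continuous_openin_preimage_gen[OF u]) auto
  then show False
    using dense[of "V \<inter> u -` (- {0})"] x \<open>u x \<noteq> 0\<close> openin_Euclidean_space_iff[OF V] by auto
qed

text \<open>If \<open>n < m\<close>, invariance of domain in \<open>R\<^sup>m\<close> would make the image of \<open>g\<close> open there, although it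
  lies in the subspace \<open>R\<^sup>n\<close>, which a small change of coordinate \<open>n\<close> leaves.\<close>

lemma invariance_of_dimension_le:
  assumes U: "openin (Euclidean_space m) U" "U \<noteq> {}"
    and cont: "continuous_map (subtopology (Euclidean_space m) U) (Euclidean_space n) g"
    and inj: "inj_on g U"
  shows "m \<le> n"
proof (rule ccontr)
  assume "\<not> m \<le> n"
  then have nm: "n < m" by simp
  have sub: "Rn n \<subseteq> Rn m" using nm by (auto simp: topspace_Euclidean_space)
  have *: "Euclidean_space n = subtopology (Euclidean_space m) (Rn n)"
    by (metis Euclidean_space_def sub inf.absorb2 subtopology_subtopology topspace_Euclidean_space
        subset_Euclidean_space inf.absorb_iff2)
  have "continuous_map (subtopology (Euclidean_space m) U) (Euclidean_space m) g"
    using cont by (subst (asm) *) (simp add: continuous_map_in_subtopology)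
  then have op: "openin (Euclidean_space m) (g ` U)"
    using invariance_of_domain_Euclidean_space[OF U(1) _ inj] by blast
  obtain y where y: "y \<in> g ` U" using U(2) by blast
  have "g ` U \<subseteq> Rn n"
    using continuous_map_image_subset_topspace[OF cont] openin_subset[OF U(1)]
    by (simp add: Int_absorb1)
  obtain d where d: "d > 0" "\<And>t. dist t (y n) < d \<Longrightarrow> y(n := t) \<in> g ` U"
    using eventually_line_in[OF op y nm] unfolding eventually_nhds_metric by blast
  have "y(n := y n + d/2) \<in> Rn n" "y \<in> Rn n"
    using d(2)[of "y n + d/2"] d(1) \<open>g ` U \<subseteq> Rn n\<close> y by (auto simp: dist_real_def)
  then have "y n + d/2 = 0" "y n = 0"
    by (auto simp: topspace_Euclidean_space dest: spec[of _ n])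
  with d(1) show False by simp
qed

section \<open>Smooth functions\<close>

lemma DERIV_line_cong:
  assumes U: "openin (Euclidean_space k) U" "x \<in> U" "i < k" and eq: "\<And>y. y \<in> U \<Longrightarrow> u y = v y"
  shows "((\<lambda>t. u (x(i := t))) has_real_derivative D) (at (x i)) \<longleftrightarrow>
    ((\<lambda>t. v (x(i := t))) has_real_derivative D) (at (x i))"
proof -
  have "eventually (\<lambda>t. u (x(i := t)) = v (x(i := t))) (nhds (x i))"
    using eventually_line_in[OF U] by eventually_elim (rule eq)
  from DERIV_cong_ev[OF refl this refl] show ?thesis .
qed

lemma partial_deriv_cong:
  assumes "openin (Euclidean_space k) U" "x \<in> U" "i < k" "\<And>y. y \<in> U \<Longrightarrow> u y = v y"
  shows "partial_deriv i u x = partial_deriv i v x"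
  using DERIV_line_cong[where u = u and v = v, OF assms] by (simp add: partial_deriv_def deriv_def)

lemma smooth_fun_on_cong:
  assumes U: "openin (Euclidean_space k) U" and "smooth_fun_on k U u" "\<And>x. x \<in> U \<Longrightarrow> v x = u x"
  shows "smooth_fun_on k U v"
proof (rule smooth_fun_on_coinduct[OF U,
      where P = "\<lambda>w. \<exists>u. smooth_fun_on k U u \<and> (\<forall>x\<in>U. w x = u x)"])
  show "\<exists>u. smooth_fun_on k U u \<and> (\<forall>x\<in>U. v x = u x)" using assms by blast
  fix w assume "\<exists>u. smooth_fun_on k U u \<and> (\<forall>x\<in>U. w x = u x)"
  then obtain u where u: "smooth_fun_on k U u" "\<And>x. x \<in> U \<Longrightarrow> w x = u x" by blast
  show "continuous_on U w"
    using smooth_fun_onD(1)[OF u(1)] u(2) continuous_on_cong[OF refl, of U w u] by simp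
  show "\<exists>v. (\<exists>u. smooth_fun_on k U u \<and> (\<forall>x\<in>U. v x = u x)) \<and>
      (\<forall>x\<in>U. ((\<lambda>t. w (x(i := t))) has_real_derivative v x) (at (x i)))" if i: "i < k" for i
  proof (intro exI conjI ballI)
    show "smooth_fun_on k U (partial_deriv i u)" by (rule smooth_fun_onD(3)[OF u(1) i])
    fix x assume x: "x \<in> U"
    show "((\<lambda>t. w (x(i := t))) has_real_derivative partial_deriv i u x) (at (x i))"
      using DERIV_line_cong[where u = w and v = u, OF U x i u(2)] smooth_fun_onD(2)[OF u(1) i x] by simp
  qed simp
qed

lemma smooth_on_cong:
  assumes "smooth_on k U m f" "\<And>x. x \<in> U \<Longrightarrow> g x = f x"
  shows "smooth_on k U m g"
proof -
  have U: "openin (Euclidean_space k) U" using assms by (simp add: smooth_on_def)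
  have "smooth_fun_on k U (\<lambda>x. g x j)" if "j < m" for j
    using smooth_fun_on_cong[OF U, of "\<lambda>x. f x j" "\<lambda>x. g x j"] assms that
    by (simp add: smooth_on_def)
  then show ?thesis using assms by (auto simp: smooth_on_def Pi_iff)
qed

lemma smooth_fun_on_diff:
  assumes U: "openin (Euclidean_space k) U" and "smooth_fun_on k U u" "smooth_fun_on k U v"
  shows "smooth_fun_on k U (\<lambda>x. u x - v x)"
proof (rule smooth_fun_on_coinduct[OF U, where
      P = "\<lambda>w. \<exists>u v. w = (\<lambda>x. u x - v x) \<and> smooth_fun_on k U u \<and> smooth_fun_on k U v"])
  show "\<exists>u' v'. (\<lambda>x. u x - v x) = (\<lambda>x. u' x - v' x) \<and> smooth_fun_on k U u' \<and> smooth_fun_on k U v'"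
    using assms by blast
  fix w assume "\<exists>u v. w = (\<lambda>x. u x - v x) \<and> smooth_fun_on k U u \<and> smooth_fun_on k U v"
  then obtain u v where w: "w = (\<lambda>x. u x - v x)" and uv: "smooth_fun_on k U u" "smooth_fun_on k U v"
    by blast
  show "continuous_on U w"
    unfolding w using uv[THEN smooth_fun_onD(1)] by (intro continuous_on_diff)
  show "\<exists>v. (\<exists>u' v'. v = (\<lambda>x. u' x - v' x) \<and> smooth_fun_on k U u' \<and> smooth_fun_on k U v') \<and>
      (\<forall>x\<in>U. ((\<lambda>t. w (x(i := t))) has_real_derivative v x) (at (x i)))" if i: "i < k" for i
  proof (intro exI conjI ballI)
    show "smooth_fun_on k U (partial_deriv i u)" "smooth_fun_on k U (partial_deriv i v)"
      by (intro smooth_fun_onD(3) uv i)+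
    show "((\<lambda>t. w (x(i := t))) has_real_derivative partial_deriv i u x - partial_deriv i v x)
        (at (x i))" if "x \<in> U" for x
      unfolding w by (intro DERIV_diff smooth_fun_onD(2)[OF _ i that] uv)
  qed simp
qed

lemma DERIV_affine_line:
  fixes i k :: nat
  assumes "i < k"
  shows "((\<lambda>t. (\<Sum>j<k. a j * (x(i := t)) j) + b) has_real_derivative a i) (at s)"
proof -
  have "((\<lambda>t. a j * (x(i := t)) j) has_real_derivative (if j = i then a i else 0)) (at s)" for j
    by (auto intro!: derivative_eq_intros)
  then have "((\<lambda>t. (\<Sum>j<k. a j * (x(i := t)) j) + b) has_real_derivative
      (\<Sum>j<k. if j = i then a i else 0) + 0) (at s)"
    by (intro DERIV_add DERIV_sum DERIV_const) auto
  moreover have "(\<Sum>j<k. if j = i then a i else 0) + 0 = a i" using assms by simp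
  ultimately show ?thesis by (simp only:)
qed

text \<open>Affine functions are closed under partial derivatives, since constants are affine.\<close>

lemma smooth_fun_on_affine:
  assumes U: "openin (Euclidean_space k) U"
  shows "smooth_fun_on k U (\<lambda>x. (\<Sum>j<k. a j * x j) + b)"
proof (rule smooth_fun_on_coinduct[OF U,
      where P = "\<lambda>w. \<exists>a b. w = (\<lambda>x. (\<Sum>j<k. a j * x j) + b)"])
  fix w :: "(nat \<Rightarrow> real) \<Rightarrow> real" assume "\<exists>a b. w = (\<lambda>x. (\<Sum>j<k. a j * x j) + b)"
  then obtain a b where w: "w = (\<lambda>x. (\<Sum>j<k. a j * x j) + b)" by blast
  show "continuous_on U w"
    unfolding w
    by (intro continuous_on_add continuous_on_sum continuous_on_mult continuous_on_const)
       (rule continuous_on_subset[OF continuous_on_product_coordinates], simp)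
  show "\<exists>v. (\<exists>a b. v = (\<lambda>x. (\<Sum>j<k. a j * x j) + b)) \<and>
      (\<forall>x\<in>U. ((\<lambda>t. w (x(i := t))) has_real_derivative v x) (at (x i)))" if i: "i < k" for i
  proof (intro exI conjI ballI)
    show "(\<lambda>x. a i) = (\<lambda>x. (\<Sum>j<k. 0 * x j) + a i)" by simp
    show "((\<lambda>t. w (x(i := t))) has_real_derivative a i) (at (x i))" for x
      unfolding w by (rule DERIV_affine_line[OF i])
  qed
qed blast

lemma smooth_on_affine_map:
  assumes "affine_map n T" "T \<in> Rn n \<rightarrow> Rn n" "openin (Euclidean_space n) U"
  shows "smooth_on n U n T"
proof -
  obtain a b where T: "\<And>x. x \<in> Rn n \<Longrightarrow> T x = (\<lambda>i. if i < n then (\<Sum>j<n. a i j * x j) + b i else 0)"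
    using assms(1) unfolding affine_map_def by blast
  have U: "U \<subseteq> Rn n" by (rule openin_subset[OF assms(3)])
  have "smooth_fun_on n U (\<lambda>x. T x i)" if "i < n" for i
    using that U T
    by (intro smooth_fun_on_cong[OF assms(3) smooth_fun_on_affine[OF assms(3), of "a i" "b i"]]) auto
  then show ?thesis using assms U by (auto simp: smooth_on_def)
qed

lemma second_partial_affine:
  assumes W: "openin (Euclidean_space k) W" and eq: "\<And>y. y \<in> W \<Longrightarrow> w y = (\<Sum>j<k. a j * y j) + b"
    and "x \<in> W" "i < k" "l < k"
  shows "partial_deriv i (partial_deriv l w) x = 0"
proof -
  have "partial_deriv l w y = a l" if "y \<in> W" for y
  proof -
    have "partial_deriv l w y = partial_deriv l (\<lambda>y. (\<Sum>j<k. a j * y j) + b) y"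
      by (rule partial_deriv_cong[OF W that \<open>l < k\<close> eq])
    then show ?thesis
      using DERIV_imp_deriv[OF DERIV_affine_line[OF \<open>l < k\<close>]] by (simp add: partial_deriv_def)
  qed
  then have "partial_deriv i (partial_deriv l w) x = partial_deriv i (\<lambda>_. a l) x"
    by (rule partial_deriv_cong[OF W \<open>x \<in> W\<close> \<open>i < k\<close>])
  then show ?thesis by (simp add: partial_deriv_def)
qed

text \<open>Two points of a cube are joined by a path inside it that changes one coordinate at a time.\<close>

lemma constant_on_cube:
  assumes U: "cube k c e \<subseteq> U"
    and u: "smooth_fun_on k U u"
    and zero: "\<And>y i. y \<in> cube k c e \<Longrightarrow> i < k \<Longrightarrow> partial_deriv i u y = 0"
    and x: "x \<in> cube k c e" and y: "y \<in> cube k c e"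
  shows "u x = u y"
proof -
  \<comment> \<open>\<open>z 0 = x\<close> and \<open>z k = y\<close>\<close>
  define z where "z = (\<lambda>j i. if i < j then y i else x i)"
  have step: "u (z (Suc j)) = u (z j)" if j: "j < k" for j
  proof -
    have upd: "z (Suc j) = (z j)(j := y j)" "z j = (z j)(j := x j)"
      by (auto simp: z_def fun_eq_iff)
    have "\<bar>x j - c j\<bar> < e" "\<bar>y j - c j\<bar> < e" using x y j by (auto simp: cube_def)
    then have inB: "(z j)(j := t) \<in> cube k c e" if "t \<in> closed_segment (x j) (y j)" for t
    proof -
      have "t \<in> {c j - e<..<c j + e}"
        using that \<open>\<bar>x j - c j\<bar> < e\<close> \<open>\<bar>y j - c j\<bar> < e\<close>
        by (auto simp: closed_segment_eq_real_ivl abs_less_iff split: if_splits)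
      then have "\<bar>t - c j\<bar> < e" by (auto simp: abs_less_iff)
      then show ?thesis
        using x y j by (auto simp: cube_def z_def topspace_Euclidean_space)
    qed
    have "((\<lambda>t. u ((z j)(j := t))) has_real_derivative 0)
        (at t within closed_segment (x j) (y j))" if "t \<in> closed_segment (x j) (y j)" for t
    proof -
      have "(z j)(j := t) \<in> U" using inB[OF that] U by blast
      from smooth_fun_onD(2)[OF u j this] zero[OF inB[OF that] j]
      show ?thesis by (simp add: has_field_derivative_at_within)
    qed
    then have "\<exists>a. \<forall>t\<in>closed_segment (x j) (y j). u ((z j)(j := t)) = a"
      using has_field_derivative_zero_constant[OF convex_closed_segment,
          where f = "\<lambda>t. u ((z j)(j := t))"] by blast
    then have "u ((z j)(j := y j)) = u ((z j)(j := x j))"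
      by (metis ends_in_segment)
    then show ?thesis unfolding upd(1) by (subst (2) upd(2))
  qed
  have "j \<le> k \<Longrightarrow> u (z j) = u (z 0)" for j
    by (induction j) (simp_all add: step)
  then have "u (z k) = u (z 0)" by blast
  moreover have "z k = y"
  proof
    fix i
    have "x i = y i" if "\<not> i < k"
      using x y that by (simp add: cube_def topspace_Euclidean_space)
    then show "z k i = y i" by (simp add: z_def)
  qed
  moreover have "z 0 = x" by (simp add: z_def)
  ultimately show ?thesis by simp
qed

section \<open>Smooth maps that agree pointwise with countably many affine maps\<close>

text \<open>The rigidity step. Baire's theorem supplies, inside every non-empty open set, an open subset on
  which \<open>u\<close> is a single element of \<open>\<Gamma>\<close>. A merely continuous \<open>u\<close> could still switch between
  infinitely many elements, as a Cantor function switches between constants; two continuous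
  derivatives exclude this.\<close>

lemma smooth_locally_in_countable_affine:
  assumes u: "smooth_on n V n u" and "r \<in> V" and "countable \<Gamma>"
    and aff: "\<And>\<gamma>. \<gamma> \<in> \<Gamma> \<Longrightarrow> affine_map n \<gamma> \<and> \<gamma> \<in> Rn n \<rightarrow> Rn n"
    and pt: "\<And>x. x \<in> V \<Longrightarrow> \<exists>\<gamma>\<in>\<Gamma>. u x = \<gamma> x"
  obtains \<gamma> B where "\<gamma> \<in> \<Gamma>" "openin (Euclidean_space n) B" "r \<in> B" "B \<subseteq> V"
    "\<And>x. x \<in> B \<Longrightarrow> u x = \<gamma> x"
proof -
  have V: "openin (Euclidean_space n) V" using u by (simp add: smooth_on_def)
  have VR: "V \<subseteq> Rn n" by (rule openin_subset[OF V])
  have interior: "\<exists>\<gamma>\<in>\<Gamma>. \<exists>W. openin (Euclidean_space n) W \<and> W \<noteq> {} \<and> W \<subseteq> V' \<and> (\<forall>x\<in>W. u x = \<gamma> x)"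
    if V': "openin (Euclidean_space n) V'" "V' \<noteq> {}" "V' \<subseteq> V" for V'
  proof -
    have closed: "closedin (top_of_set V') {x \<in> V'. u x = \<gamma> x}" if "\<gamma> \<in> \<Gamma>" for \<gamma>
    proof -
      have "continuous_map (top_of_set V') euclidean u"
        using continuous_on_subset[OF smooth_on_continuous[OF u] V'(3)] by simp
      moreover have "continuous_map (top_of_set V') euclidean \<gamma>"
        using smooth_on_continuous[OF smooth_on_affine_map[OF _ _ V'(1)], of \<gamma>] aff[OF that] by simp
      ultimately have "closedin (top_of_set V') {x \<in> topspace (top_of_set V'). u x = \<gamma> x}"
        by (intro closedin_continuous_maps_eq[of euclidean]) auto
      then show ?thesis by simp
    qed
    have cover: "V' \<subseteq> (\<Union>\<gamma>\<in>\<Gamma>. {x \<in> V'. u x = \<gamma> x})" using pt V'(3) by blast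
    show ?thesis
      by (rule countable_closed_cover_interior[OF V'(1,2) \<open>countable \<Gamma>\<close> cover closed]) blast+
  qed
  obtain e where e: "e > 0" "cube n r e \<subseteq> V"
      "openin (Euclidean_space n) (cube n r e)"
    using open_cube[OF V \<open>r \<in> V\<close>] by blast
  define B where "B = cube n r e"
  have B: "openin (Euclidean_space n) B" "B \<subseteq> V" "r \<in> B"
    using e \<open>r \<in> V\<close> VR unfolding B_def cube_def by auto
  \<comment> \<open>Any \<open>\<gamma>\<close> that agrees with \<open>u\<close> on a non-empty open part of the cube agrees with it everywhere.\<close>
  obtain \<gamma> W where \<gamma>: "\<gamma> \<in> \<Gamma>" and W: "openin (Euclidean_space n) W" "W \<noteq> {}" "W \<subseteq> B"
      "\<And>x. x \<in> W \<Longrightarrow> u x = \<gamma> x"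
    using interior[of B] B by blast
  obtain p where p: "p \<in> W" using W(2) by blast
  have "u x j = \<gamma> x j" if j: "j < n" and x: "x \<in> B" for x j
  proof -
    define w where "w = (\<lambda>x. u x j - \<gamma> x j)"
    have w: "smooth_fun_on n V w"
      unfolding w_def using u smooth_on_affine_map[OF _ _ V, of \<gamma>] aff[OF \<gamma>] j
      by (intro smooth_fun_on_diff[OF V]) (auto simp: smooth_on_def)
    have second: "partial_deriv i (partial_deriv l w) y = 0"
      if i: "i < n" and l: "l < n" and y: "y \<in> B" for i l y
    proof (rule continuous_zero_of_dense[OF B(1) _ _ y])
      have "continuous_on V (partial_deriv i (partial_deriv l w))"
        by (rule smooth_fun_onD(1)[OF smooth_fun_onD(3)[OF smooth_fun_onD(3)[OF w l] i]])
      then show "continuous_on B (partial_deriv i (partial_deriv l w))"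
        using B(2) by (rule continuous_on_subset)
      fix V' assume V': "openin (Euclidean_space n) V'" "V' \<noteq> {}" "V' \<subseteq> B"
      then obtain \<gamma>' W' where \<gamma>': "\<gamma>' \<in> \<Gamma>" and W': "openin (Euclidean_space n) W'" "W' \<noteq> {}"
          "W' \<subseteq> V'" "\<And>x. x \<in> W' \<Longrightarrow> u x = \<gamma>' x"
        using interior[of V'] B(2) by blast
      obtain a b where a: "\<And>x. x \<in> Rn n \<Longrightarrow> \<gamma> x = (\<lambda>i. if i < n then (\<Sum>j<n. a i j * x j) + b i else 0)"
        using aff[OF \<gamma>] unfolding affine_map_def by blast
      obtain a' b' where a': "\<And>x. x \<in> Rn n \<Longrightarrow> \<gamma>' x = (\<lambda>i. if i < n then (\<Sum>j<n. a' i j * x j) + b' i else 0)"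
        using aff[OF \<gamma>'] unfolding affine_map_def by blast
      obtain q where q: "q \<in> W'" using W'(2) by blast
      have "w y = (\<Sum>m<n. (a' j m - a j m) * y m) + (b' j - b j)" if "y \<in> W'" for y
      proof -
        have "y \<in> Rn n" using that W'(1) openin_subset by blast
        then show ?thesis
          using j by (simp add: w_def W'(4)[OF that] a a' left_diff_distrib sum_subtractf)
      qed
      from second_partial_affine[OF W'(1) this q i l]
      show "\<exists>x\<in>V'. partial_deriv i (partial_deriv l w) x = 0"
        using q W'(3) by blast
    qed
    have w0: "w y = 0" if "y \<in> W" for y
      using W(4)[OF that] by (simp add: w_def)
    have pB: "p \<in> B" using p W(3) by blast
    have first: "partial_deriv l w y = 0" if l: "l < n" and y: "y \<in> B" for l y
    proof -
      have "partial_deriv l w y = partial_deriv l w p"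
        using constant_on_cube[OF e(2) smooth_fun_onD(3)[OF w l], folded B_def] second l y pB by blast
      also have "\<dots> = partial_deriv l (\<lambda>_. 0) p"
        by (rule partial_deriv_cong[OF W(1) p l w0])
      finally show ?thesis by (simp add: partial_deriv_def)
    qed
    have "w x = w p"
      using constant_on_cube[OF e(2) w, folded B_def] first x pB by blast
    then show ?thesis using w0[OF p] by (simp add: w_def)
  qed
  moreover have "u x j = \<gamma> x j" if "\<not> j < n" "x \<in> B" for x j
  proof -
    have "x \<in> V" "x \<in> Rn n" using that B(2) VR by auto
    then have "u x \<in> Rn n" "\<gamma> x \<in> Rn n" using u aff[OF \<gamma>] by (auto simp: smooth_on_def)
    then show ?thesis using that by (simp add: topspace_Euclidean_space)
  qed
  ultimately have "u x = \<gamma> x" if "x \<in> B" for x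
    using that by (intro ext) blast
  then show thesis using that \<gamma> B by blast
qed


section \<open>Orbits of subgroups of the affine group\<close>

lemma subgroup_AffD:
  assumes "subgroup \<Gamma> (Aff n)" "\<gamma> \<in> \<Gamma>"
  shows "affine_map n \<gamma>" "\<gamma> \<in> Bij (Rn n)" "\<gamma> \<in> Rn n \<rightarrow> Rn n"
proof -
  have "\<gamma> \<in> carrier (Aff n)" using subgroup.subset[OF assms(1)] assms(2) by blast
  then show "affine_map n \<gamma>" "\<gamma> \<in> Bij (Rn n)" by (auto simp: Aff_def)
  then show "\<gamma> \<in> Rn n \<rightarrow> Rn n" by (intro Bij_imp_funcset)
qed

lemma Aff_mult:
  assumes "\<gamma> \<in> carrier (Aff n)" "\<delta> \<in> carrier (Aff n)" "x \<in> Rn n"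
  shows "(\<gamma> \<otimes>\<^bsub>Aff n\<^esub> \<delta>) x = \<gamma> (\<delta> x)"
  using assms by (simp add: Aff_def BijGroup_def compose_def)

lemma Aff_one: "x \<in> Rn n \<Longrightarrow> \<one>\<^bsub>Aff n\<^esub> x = x"
  by (simp add: Aff_def BijGroup_def)

lemma in_proj_self:
  assumes "subgroup \<Gamma> (Aff n)" "x \<in> Rn n"
  shows "x \<in> proj n \<Gamma> x"
  using Aff_one[OF assms(2)] subgroup.one_closed[OF assms(1)]
  by (metis (mono_tags, lifting) mem_Collect_eq proj_eq)

lemma subgroup_Aff_inverse:
  assumes \<Gamma>: "subgroup \<Gamma> (Aff n)" and \<gamma>: "\<gamma> \<in> \<Gamma>"
  obtains \<delta> where "\<delta> \<in> \<Gamma>" "\<And>x. x \<in> Rn n \<Longrightarrow> \<delta> (\<gamma> x) = x"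
proof
  interpret group "Aff n" by (rule group_Aff)
  show inv: "inv\<^bsub>Aff n\<^esub> \<gamma> \<in> \<Gamma>" by (rule subgroup.m_inv_closed[OF \<Gamma> \<gamma>])
  have car: "\<gamma> \<in> carrier (Aff n)" "inv\<^bsub>Aff n\<^esub> \<gamma> \<in> carrier (Aff n)"
    using subgroup.subset[OF \<Gamma>] \<gamma> inv by blast+
  show "(inv\<^bsub>Aff n\<^esub> \<gamma>) (\<gamma> x) = x" if "x \<in> Rn n" for x
    using Aff_mult[OF car(2,1) that] Aff_one[OF that] l_inv[OF car(1)] by simp
qed

lemma proj_subset_proj:
  assumes \<Gamma>: "subgroup \<Gamma> (Aff n)" and "\<gamma> \<in> \<Gamma>" "x \<in> Rn n"
  shows "proj n \<Gamma> (\<gamma> x) \<subseteq> proj n \<Gamma> x"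
proof
  fix y assume "y \<in> proj n \<Gamma> (\<gamma> x)"
  then obtain \<delta> where \<delta>: "\<delta> \<in> \<Gamma>" "y = \<delta> (\<gamma> x)" by (auto simp: proj_eq)
  have car: "\<delta> \<in> carrier (Aff n)" "\<gamma> \<in> carrier (Aff n)"
    using subgroup.subset[OF \<Gamma>] \<delta>(1) assms(2) by blast+
  have "\<delta> \<otimes>\<^bsub>Aff n\<^esub> \<gamma> \<in> \<Gamma>" by (rule subgroup.m_closed[OF \<Gamma> \<delta>(1) assms(2)])
  moreover have "y = (\<delta> \<otimes>\<^bsub>Aff n\<^esub> \<gamma>) x"
    using Aff_mult[OF car assms(3)] \<delta>(2) by simp
  ultimately show "y \<in> proj n \<Gamma> x" unfolding proj_eq by blast
qed

lemma proj_act: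
  assumes \<Gamma>: "subgroup \<Gamma> (Aff n)" and \<gamma>: "\<gamma> \<in> \<Gamma>" and x: "x \<in> Rn n"
  shows "proj n \<Gamma> (\<gamma> x) = proj n \<Gamma> x"
proof
  show "proj n \<Gamma> (\<gamma> x) \<subseteq> proj n \<Gamma> x" by (rule proj_subset_proj[OF assms])
  obtain \<delta> where \<delta>: "\<delta> \<in> \<Gamma>" "\<delta> (\<gamma> x) = x" using subgroup_Aff_inverse[OF \<Gamma> \<gamma>] x by metis
  have "\<gamma> x \<in> Rn n" using subgroup_AffD(3)[OF \<Gamma> \<gamma>] x by blast
  from proj_subset_proj[OF \<Gamma> \<delta>(1) this] show "proj n \<Gamma> x \<subseteq> proj n \<Gamma> (\<gamma> x)"
    by (simp add: \<delta>(2))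
qed

lemma proj_eq_imp:
  assumes "subgroup \<Gamma> (Aff n)" "y \<in> Rn n" "proj n \<Gamma> y = proj n \<Gamma> x"
  shows "\<exists>\<gamma>\<in>\<Gamma>. y = \<gamma> x"
  using in_proj_self[OF assms(1,2)] assms(3) by (auto simp: proj_eq)

section \<open>Local smooth liftings\<close>

lemma openin_proj_preimage:
  assumes A: "openin (D_topology (quot n \<Gamma>) (quot_diffeology n \<Gamma>)) A"
  shows "openin (Euclidean_space n) {r \<in> Rn n. proj n \<Gamma> r \<in> A}"
    "(n, {r \<in> Rn n. proj n \<Gamma> r \<in> A}, restrict (proj n \<Gamma>) {r \<in> Rn n. proj n \<Gamma> r \<in> A})
      \<in> subset_diffeology (quot_diffeology n \<Gamma>) A"
proof -
  have id: "smooth_on n U n (\<lambda>x. x)" if "openin (Euclidean_space n) U" for U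
    using that openin_subset[OF that]
    by (intro smooth_on_affine_map) (auto simp: affine_map_def fun_eq_iff topspace_Euclidean_space
        if_distrib[of "\<lambda>c. c * _"] cong: if_cong
        intro!: exI[of _ "\<lambda>i j. if i = j then 1 else 0"] exI[of _ "\<lambda>_. 0"])
  have plot: "(n, U, restrict (proj n \<Gamma>) U) \<in> quot_diffeology n \<Gamma>"
    if U: "openin (Euclidean_space n) U" for U
    unfolding quot_diffeology_def params_def
    using U id[OF U] openin_subset[OF U]
    by (auto simp: quot_eq intro!: exI[of _ U] exI[of _ "\<lambda>x. x"])
  have "(n, Rn n, restrict (proj n \<Gamma>) (Rn n)) \<in> quot_diffeology n \<Gamma>"
    by (rule plot) simp
  with A have "openin (Euclidean_space n) {r \<in> Rn n. restrict (proj n \<Gamma>) (Rn n) r \<in> A}"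
    unfolding openin_D_topology by blast
  moreover have "{r \<in> Rn n. restrict (proj n \<Gamma>) (Rn n) r \<in> A} = {r \<in> Rn n. proj n \<Gamma> r \<in> A}"
    by auto
  ultimately show op: "openin (Euclidean_space n) {r \<in> Rn n. proj n \<Gamma> r \<in> A}" by simp
  show "(n, {r \<in> Rn n. proj n \<Gamma> r \<in> A}, restrict (proj n \<Gamma>) {r \<in> Rn n. proj n \<Gamma> r \<in> A})
      \<in> subset_diffeology (quot_diffeology n \<Gamma>) A"
    using plot[OF op] by (auto simp: subset_diffeology_def)
qed

text \<open>The projection restricted to the preimage of \<open>A\<close> is a plot, so its composite with the smooth \<open>f\<close>
  is a plot of the second quotient, and plots of a quotient lift locally.\<close>

lemma lifting_exists:
  assumes A: "openin (D_topology (quot n \<Gamma>) (quot_diffeology n \<Gamma>)) A"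
    and f: "dsmooth A (subset_diffeology (quot_diffeology n \<Gamma>) A)
      A' (subset_diffeology (quot_diffeology n' \<Gamma>') A') f"
    and r: "r \<in> Rn n" "proj n \<Gamma> r \<in> A"
  obtains V g where "local_smooth_lifting n \<Gamma> n' \<Gamma>' A f V g" "r \<in> V"
proof -
  define U where "U = {r \<in> Rn n. proj n \<Gamma> r \<in> A}"
  have "(n, U, compose U f (restrict (proj n \<Gamma>) U))
      \<in> subset_diffeology (quot_diffeology n' \<Gamma>') A'"
    using f openin_proj_preimage(2)[OF A] unfolding dsmooth_def U_def by blast
  then have "\<exists>V s. r \<in> V \<and> V \<subseteq> U \<and> smooth_on n V n' s \<and>
      (\<forall>x\<in>V. proj n' \<Gamma>' (s x) = compose U f (restrict (proj n \<Gamma>) U) x)"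
    using r by (auto simp: subset_diffeology_def quot_diffeology_def U_def)
  then obtain V s where V: "r \<in> V" "V \<subseteq> U" "smooth_on n V n' s"
      "\<forall>x\<in>V. proj n' \<Gamma>' (s x) = compose U f (restrict (proj n \<Gamma>) U) x"
    by blast
  then have "local_smooth_lifting n \<Gamma> n' \<Gamma>' A f V s"
    unfolding local_smooth_lifting_def using V(2)
    by (auto simp: smooth_on_def compose_def U_def[symmetric] subset_iff)
  then show thesis using that V(1) by blast
qed

text \<open>Composing a lifting with an element of \<open>\<Gamma>'\<close> gives a lifting of the same map.\<close>

lemma lifting_through_point:
  assumes \<Gamma>': "subgroup \<Gamma>' (Aff n')"
    and A: "openin (D_topology (quot n \<Gamma>) (quot_diffeology n \<Gamma>)) A"
    and f: "dsmooth A (subset_diffeology (quot_diffeology n \<Gamma>) A)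
      A' (subset_diffeology (quot_diffeology n' \<Gamma>') A') f"
    and r: "r \<in> Rn n" "proj n \<Gamma> r \<in> A"
    and r': "r' \<in> Rn n'" "proj n' \<Gamma>' r' = f (proj n \<Gamma> r)"
  obtains V g where "local_smooth_lifting n \<Gamma> n' \<Gamma>' A f V g" "r \<in> V" "g r = r'"
proof -
  obtain V g where g: "local_smooth_lifting n \<Gamma> n' \<Gamma>' A f V g" and rV: "r \<in> V"
    using lifting_exists[OF A f r] by blast
  have sm: "smooth_on n V n' g" and V: "g \<in> V \<rightarrow> Rn n'" "\<And>x. x \<in> V \<Longrightarrow> proj n' \<Gamma>' (g x) = f (proj n \<Gamma> x)"
    using g by (auto simp: local_smooth_lifting_def smooth_on_def)
  obtain \<gamma> where \<gamma>: "\<gamma> \<in> \<Gamma>'" "r' = \<gamma> (g r)"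
    using proj_eq_imp[OF \<Gamma>' r'(1), of "g r"] r'(2) V(2)[OF rV] by auto
  have "openin (Euclidean_space n') (Rn n')" by simp
  then have \<gamma>_smooth: "smooth_on n' (Rn n') n' \<gamma>"
    using subgroup_AffD[OF \<Gamma>' \<gamma>(1)] by (intro smooth_on_affine_map)
  have "smooth_on n V n' (\<lambda>x. \<gamma> (g x))"
    by (rule smooth_on_compose[OF sm _ \<gamma>_smooth]) (use V(1) in auto)
  moreover have "proj n' \<Gamma>' (\<gamma> (g x)) = f (proj n \<Gamma> x)" if "x \<in> V" for x
    using proj_act[OF \<Gamma>' \<gamma>(1), of "g x"] V that by auto
  ultimately have "local_smooth_lifting n \<Gamma> n' \<Gamma>' A f V (\<lambda>x. \<gamma> (g x))"
    using g by (auto simp: local_smooth_lifting_def)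
  then show thesis using that[of V "\<lambda>x. \<gamma> (g x)"] rV \<gamma>(2) by blast
qed

text \<open>Here \<open>h = \<delta> \<circ> h\<^sub>0\<close>, where \<open>h\<^sub>0\<close> lifts the inverse \<open>f'\<close> around \<open>g r\<close> and \<open>\<delta>\<close> undoes the element
  of \<open>\<Gamma>\<close> that \<open>h\<^sub>0 \<circ> g\<close> equals near \<open>r\<close>. The inverse of \<open>f\<close> is an arbitrary map \<open>f'\<close>, which keeps
  the two quotients interchangeable.\<close>

lemma lifting_smooth_left_inverse:
  assumes \<Gamma>: "subgroup \<Gamma> (Aff n)" "countable \<Gamma>"
    and A': "openin (D_topology (quot n' \<Gamma>') (quot_diffeology n' \<Gamma>')) A'"
    and f': "dsmooth A' (subset_diffeology (quot_diffeology n' \<Gamma>') A')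
      A (subset_diffeology (quot_diffeology n \<Gamma>) A) f'"
    and f: "f \<in> A \<rightarrow> A'" and inv: "\<And>x. x \<in> A \<Longrightarrow> f' (f x) = x"
    and g: "local_smooth_lifting n \<Gamma> n' \<Gamma>' A f V g" and r: "r \<in> V"
  obtains B W h where "openin (Euclidean_space n) B" "r \<in> B" "B \<subseteq> V" "g ` B \<subseteq> W"
    "smooth_on n' W n h" "\<And>x. x \<in> B \<Longrightarrow> h (g x) = x"
proof -
  have sm: "smooth_on n V n' g" and VA: "V \<subseteq> {r \<in> Rn n. proj n \<Gamma> r \<in> A}"
    and gV: "g \<in> V \<rightarrow> Rn n'" and lift: "\<And>x. x \<in> V \<Longrightarrow> proj n' \<Gamma>' (g x) = f (proj n \<Gamma> x)"
    using g by (auto simp: local_smooth_lifting_def smooth_on_def)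
  have "proj n' \<Gamma>' (g r) \<in> A'" using lift[OF r] f VA r by auto
  then obtain W h where h: "local_smooth_lifting n' \<Gamma>' n \<Gamma> A' f' W h" and W: "g r \<in> W"
    using lifting_exists[OF A' f', of "g r"] gV r by blast
  have smh: "smooth_on n' W n h" and hlift: "\<And>y. y \<in> W \<Longrightarrow> proj n \<Gamma> (h y) = f' (proj n' \<Gamma>' y)"
    and oW: "openin (Euclidean_space n') W"
    using h by (auto simp: local_smooth_lifting_def smooth_on_def)
  define V' where "V' = {x \<in> V. g x \<in> W}"
  have V': "openin (Euclidean_space n) V'" "V' \<subseteq> V" "g ` V' \<subseteq> W" "r \<in> V'"
    using openin_preimage_smooth[OF sm oW] r W by (auto simp: V'_def)
  have hg: "smooth_on n V' n (\<lambda>x. h (g x))"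
    by (rule smooth_on_compose[OF smooth_on_subset[OF sm V'(1,2)] V'(3) smh])
  have orbit: "\<exists>\<gamma>\<in>\<Gamma>. h (g x) = \<gamma> x" if x: "x \<in> V'" for x
  proof (rule proj_eq_imp[OF \<Gamma>(1)])
    show "h (g x) \<in> Rn n" using hg x by (auto simp: smooth_on_def)
    show "proj n \<Gamma> (h (g x)) = proj n \<Gamma> x"
    proof -
      have "x \<in> V" "g x \<in> W" using x V'(2,3) by auto
      then have "proj n \<Gamma> (h (g x)) = f' (f (proj n \<Gamma> x))" using hlift lift by simp
      also have "\<dots> = proj n \<Gamma> x" using \<open>x \<in> V\<close> VA by (intro inv) auto
      finally show ?thesis .
    qed
  qed
  have aff: "affine_map n \<gamma> \<and> \<gamma> \<in> Rn n \<rightarrow> Rn n" if "\<gamma> \<in> \<Gamma>" for \<gamma>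
    using subgroup_AffD[OF \<Gamma>(1) that] by blast
  obtain \<gamma> B where \<gamma>: "\<gamma> \<in> \<Gamma>" and B: "openin (Euclidean_space n) B" "r \<in> B" "B \<subseteq> V'"
      "\<And>x. x \<in> B \<Longrightarrow> h (g x) = \<gamma> x"
    by (rule smooth_locally_in_countable_affine[OF hg V'(4) \<Gamma>(2) aff orbit]) blast+
  obtain \<delta> where \<delta>: "\<delta> \<in> \<Gamma>" "\<And>x. x \<in> Rn n \<Longrightarrow> \<delta> (\<gamma> x) = x"
    using subgroup_Aff_inverse[OF \<Gamma>(1) \<gamma>] by blast
  have \<delta>_smooth: "smooth_on n (Rn n) n \<delta>"
    using subgroup_AffD[OF \<Gamma>(1) \<delta>(1)] by (intro smooth_on_affine_map) auto
  have "smooth_on n' W n (\<lambda>y. \<delta> (h y))"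
    by (rule smooth_on_compose[OF smh _ \<delta>_smooth]) (use smh in \<open>auto simp: smooth_on_def\<close>)
  moreover have "\<delta> (h (g x)) = x" if "x \<in> B" for x
    using B(4)[OF that] \<delta>(2)[of x] that openin_subset[OF B(1)] by auto
  ultimately show thesis
    using that[of B W "\<lambda>y. \<delta> (h y)"] B V' by blast
qed

lemma dimension_le:
  assumes \<Gamma>: "subgroup \<Gamma> (Aff n)" "countable \<Gamma>"
    and A: "openin (D_topology (quot n \<Gamma>) (quot_diffeology n \<Gamma>)) A"
    and A': "openin (D_topology (quot n' \<Gamma>') (quot_diffeology n' \<Gamma>')) A'"
    and f: "dsmooth A (subset_diffeology (quot_diffeology n \<Gamma>) A)
      A' (subset_diffeology (quot_diffeology n' \<Gamma>') A') f"
    and f': "dsmooth A' (subset_diffeology (quot_diffeology n' \<Gamma>') A')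
      A (subset_diffeology (quot_diffeology n \<Gamma>) A) f'"
    and inv: "\<And>x. x \<in> A \<Longrightarrow> f' (f x) = x" and ne: "A \<noteq> {}"
  shows "n \<le> n'"
proof -
  obtain r where r: "r \<in> Rn n" "proj n \<Gamma> r \<in> A"
    using A ne by (auto simp: openin_D_topology quot_eq)
  obtain V g where g: "local_smooth_lifting n \<Gamma> n' \<Gamma>' A f V g" and "r \<in> V"
    using lifting_exists[OF A f r] by blast
  have "f \<in> A \<rightarrow> A'" using f by (simp add: dsmooth_def)
  then obtain B W h where B: "openin (Euclidean_space n) B" "r \<in> B" "B \<subseteq> V"
      "\<And>x. x \<in> B \<Longrightarrow> h (g x) = x"
    using lifting_smooth_left_inverse[OF \<Gamma> A' f' _ inv g \<open>r \<in> V\<close>] by metis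
  have "smooth_on n B n' g"
    using g by (intro smooth_on_subset[OF _ B(1,3)]) (simp add: local_smooth_lifting_def)
  moreover have "inj_on g B" using B(4) by (metis inj_onI)
  ultimately show ?thesis
    using invariance_of_dimension_le[OF B(1) _ smooth_on_continuous_map] B(2) by blast
qed

text \<open>The local left inverse inverts \<open>g\<close> on its image, which is open by invariance of domain.\<close>

lemma lifting_local_diffeo:
  assumes \<Gamma>: "subgroup \<Gamma> (Aff n)" "countable \<Gamma>"
    and A': "openin (D_topology (quot n \<Gamma>') (quot_diffeology n \<Gamma>')) A'"
    and f': "dsmooth A' (subset_diffeology (quot_diffeology n \<Gamma>') A')
      A (subset_diffeology (quot_diffeology n \<Gamma>) A) f'"
    and f: "f \<in> A \<rightarrow> A'" and inv: "\<And>x. x \<in> A \<Longrightarrow> f' (f x) = x"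
    and g: "local_smooth_lifting n \<Gamma> n \<Gamma>' A f V g" and r: "r \<in> V"
  shows "local_diffeo_around n n V g r"
proof -
  obtain B W h where B: "openin (Euclidean_space n) B" "r \<in> B" "B \<subseteq> V" "g ` B \<subseteq> W"
      and h: "smooth_on n W n h" and left: "\<And>x. x \<in> B \<Longrightarrow> h (g x) = x"
    using lifting_smooth_left_inverse[OF \<Gamma> A' f' f inv g r] by metis
  have sm: "smooth_on n B n g"
    using g by (intro smooth_on_subset[OF _ B(1,3)]) (simp add: local_smooth_lifting_def)
  have inj: "inj_on g B" using left by (metis inj_onI)
  have op: "openin (Euclidean_space n) (g ` B)"
    by (rule invariance_of_domain_Euclidean_space[OF B(1) smooth_on_continuous_map[OF sm] inj])
  have "smooth_on n (g ` B) n (inv_into B g)"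
    using left inj by (intro smooth_on_cong[OF smooth_on_subset[OF h op B(4)]]) auto
  then show ?thesis
    unfolding local_diffeo_around_def using B sm inj op by blast
qed

theorem mainTheorem2:
  fixes n n' :: nat
    and \<Gamma> \<Gamma>' :: "((nat \<Rightarrow> real) \<Rightarrow> nat \<Rightarrow> real) set"
    and A :: "(nat \<Rightarrow> real) set set"
    and f :: "(nat \<Rightarrow> real) set \<Rightarrow> (nat \<Rightarrow> real) set"
  assumes "subgroup \<Gamma> (Aff n)" and "countable \<Gamma>"
    and "subgroup \<Gamma>' (Aff n')" and "countable \<Gamma>'"
    and "local_diffeomorphism (quot n \<Gamma>) (quot_diffeology n \<Gamma>)
           (quot n' \<Gamma>') (quot_diffeology n' \<Gamma>') A f"
    and "A \<noteq> {}"
  shows "(\<forall>V g. local_smooth_lifting n \<Gamma> n' \<Gamma>' A f V g \<longrightarrow>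
            (\<forall>r\<in>V. local_diffeo_around n n' V g r)) \<and>
         n = n' \<and>
         (\<forall>x\<in>A. \<forall>r\<in>Rn n. \<forall>r'\<in>Rn n'. proj n \<Gamma> r = x \<longrightarrow> proj n' \<Gamma>' r' = f x \<longrightarrow>
            (\<exists>V g. local_smooth_lifting n \<Gamma> n' \<Gamma>' A f V g \<and> r \<in> V \<and> g r = r'))"
proof -
  have A: "openin (D_topology (quot n \<Gamma>) (quot_diffeology n \<Gamma>)) A"
    and A': "openin (D_topology (quot n' \<Gamma>') (quot_diffeology n' \<Gamma>')) (f ` A)"
    and f: "dsmooth A (subset_diffeology (quot_diffeology n \<Gamma>) A)
      (f ` A) (subset_diffeology (quot_diffeology n' \<Gamma>') (f ` A)) f"
    and f': "dsmooth (f ` A) (subset_diffeology (quot_diffeology n' \<Gamma>') (f ` A))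
      A (subset_diffeology (quot_diffeology n \<Gamma>) A) (inv_into A f)"
    and inj: "inj_on f A"
    using assms(5) by (auto simp: local_diffeomorphism_def)
  have left: "inv_into A f (f x) = x" if "x \<in> A" for x
    using inj that by (rule inv_into_f_f)
  have right: "f (inv_into A f y) = y" if "y \<in> f ` A" for y
    using that by (rule f_inv_into_f)
  have "n \<le> n'"
    by (rule dimension_le[OF assms(1,2) A A' f f' left assms(6)])
  moreover have "n' \<le> n"
    by (rule dimension_le[OF assms(3,4) A' A f' f right]) (use assms(6) in auto)
  ultimately have dim: "n = n'" by simp
  have "local_diffeo_around n n' V g r"
    if "local_smooth_lifting n \<Gamma> n' \<Gamma>' A f V g" "r \<in> V" for V g r
    using lifting_local_diffeo[OF assms(1,2), folded dim, OF A'[folded dim] f'[folded dim] _ left] that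
    unfolding dim[symmetric] by blast
  moreover have "\<exists>V g. local_smooth_lifting n \<Gamma> n' \<Gamma>' A f V g \<and> r \<in> V \<and> g r = r'"
    if "r \<in> Rn n" "r' \<in> Rn n'" "proj n \<Gamma> r \<in> A" "proj n' \<Gamma>' r' = f (proj n \<Gamma> r)" for r r'
    using lifting_through_point[OF assms(3) A f that(1,3,2,4)] by metis
  ultimately show ?thesis using dim by blast
qed

end
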